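(* Let $k = (k_1,k_2,k_3)$ be $(1,2,3)$ or $(1,2,4)$. For a prime $r$ let $\zeta_r$ be a primitive $r$-th root of unity, and for $(a,b) \in \mathbb{Z}^2\setminus\{(0,0)\}$ let $$E^k_{(a,b),r} : \quad Y^2 = X\,(X - A)(X + B),$$ where $$A = (\zeta_r^{k_3} + \zeta_r^{-k_3} - \zeta_r^{k_2} - \zeta_r^{-k_2})\,(a^2 + (\zeta_r^{k_1}+\zeta_r^{-k_1})ab + b^2),$$ $$B = (\zeta_r^{k_1} + \zeta_r^{-k_1} - \zeta_r^{k_3} - \zeta_r^{-k_3})\,(a^2 + (\zeta_r^{k_2}+\zeta_r^{-k_2})ab + b^2).$$ Then, for all primes $r > 7$ and all non-zero pairs $(a,b)\in\mathbb{Z}^2$, the elliptic curve $E^k_{(a,b),r}$, regarded over $\mathbb{Q}(\zeta_r)$, is $3$-ordinary.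
   Context: For a rational prime $p$, an elliptic curve $E$ over a number field $K$ is called $p$-ordinary if it has good ordinary reduction at all primes $\mathfrak{p} \mid p$ of $K$. Good ordinary reduction at $\mathfrak{p}$ means that $E$ has good reduction at $\mathfrak{p}$ and $p \nmid a_{\mathfrak{p}}(E)$, where $a_{\mathfrak{p}}(E) = (p^{f_{\mathfrak{p}}}+1) - \#\tilde{E}(\mathbb{F}_{p^{f_{\mathfrak{p}}}})$, $\tilde{E}$ is the reduction of $E$ modulo $\mathfrak{p}$ and $f_{\mathfrak{p}}$ is the residual degree of $\mathfrak{p}$. *)

theory Defs
  imports Complex_Main "HOL-Computational_Algebra.Computational_Algebra"
    "HOL-Algebra.Generated_Fields" "HOL-Algebra.Embedded_Algebras"
    "HOL-Algebra.Algebraic_Closure_Type"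
begin

section \<open>Number fields inside the complex numbers\<close>

text \<open>A number field is represented by a subset \<open>K\<close> of the complex numbers.  A subset \<open>S\<close> is turned
  into a ring by restricting the carrier of the ring of complex numbers.\<close>

definition subring_of_complex :: "complex set \<Rightarrow> complex ring" where
  "subring_of_complex S = (ring_of_type_algebra :: complex ring)\<lparr>carrier := S\<rparr>"

definition adjoin_rat :: "complex \<Rightarrow> complex set" where
  "adjoin_rat z = generate_field (ring_of_type_algebra :: complex ring) {z}"

definition integers_of :: "complex set \<Rightarrow> complex set" where
  "integers_of K = {x \<in> K. algebraic_int x}"

definition primes_above :: "nat \<Rightarrow> complex set \<Rightarrow> complex set set" where
  "primes_above p K =
     {P. primeideal P (subring_of_complex (integers_of K)) \<and> of_nat p \<in> P}"

definition local_ring :: "complex set \<Rightarrow> complex set \<Rightarrow> complex ring" where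
  "local_ring K P =
     subring_of_complex {x / s | x s. x \<in> integers_of K \<and> s \<in> integers_of K - P}"

definition local_maximal_ideal :: "complex set \<Rightarrow> complex set \<Rightarrow> complex set" where
  "local_maximal_ideal K P = {x / s | x s. x \<in> P \<and> s \<in> integers_of K - P}"

definition residue_field :: "complex set \<Rightarrow> complex set \<Rightarrow> complex set ring" where
  "residue_field K P = local_ring K P Quot local_maximal_ideal K P"

text \<open>The residual degree is the degree of the residue field over its prime field, the latter being
  the subfield generated by the empty set.\<close>

definition residue_degree :: "complex set \<Rightarrow> complex set \<Rightarrow> nat" where
  "residue_degree K P =
     (let k = residue_field K P in ring.dim k (generate_field k {}) (carrier k))"


section \<open>Weierstrass curves\<close>

text \<open>\<open>Weierstrass a1 a2 a3 a4 a6\<close> is the curve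
  \<open>y^2 + a1 x y + a3 y = x^3 + a2 x^2 + a4 x + a6\<close>.\<close>

datatype 'a weierstrass = Weierstrass 'a 'a 'a 'a 'a

fun discriminant :: "complex weierstrass \<Rightarrow> complex" where
  "discriminant (Weierstrass a1 a2 a3 a4 a6) =
     (let b2 = a1^2 + 4 * a2;
          b4 = 2 * a4 + a1 * a3;
          b6 = a3^2 + 4 * a6;
          b8 = a1^2 * a6 + 4 * a2 * a6 - a1 * a3 * a4 + a2 * a3^2 - a4^2
      in - (b2^2 * b8) - 8 * b4^3 - 27 * b6^2 + 9 * b2 * b4 * b6)"

definition elliptic_curve_over :: "complex set \<Rightarrow> complex weierstrass \<Rightarrow> bool" where
  "elliptic_curve_over K E \<longleftrightarrow> set_weierstrass E \<subseteq> K \<and> discriminant E \<noteq> 0"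

text \<open>The substitution \<open>x = u^2 x' + r\<close>, \<open>y = u^3 y' + s u^2 x' + t\<close>.\<close>

fun change_coords ::
  "complex \<Rightarrow> complex \<Rightarrow> complex \<Rightarrow> complex \<Rightarrow> complex weierstrass \<Rightarrow> complex weierstrass" where
  "change_coords u r s t (Weierstrass a1 a2 a3 a4 a6) =
     Weierstrass
       ((a1 + 2 * s) / u)
       ((a2 - s * a1 + 3 * r - s^2) / u^2)
       ((a3 + r * a1 + 2 * t) / u^3)
       ((a4 - s * a3 + 2 * r * a2 - (t + r * s) * a1 + 3 * r^2 - 2 * s * t) / u^4)
       ((a6 + r * a4 + r^2 * a2 + r^3 - t * a3 - t^2 - r * t * a1) / u^6)"

definition isomorphic_over :: "complex set \<Rightarrow> complex weierstrass \<Rightarrow> complex weierstrass \<Rightarrow> bool" where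
  "isomorphic_over K E E' \<longleftrightarrow>
     (\<exists>u\<in>K - {0}. \<exists>r\<in>K. \<exists>s\<in>K. \<exists>t\<in>K. E' = change_coords u r s t E)"

text \<open>The rational points over a ring \<open>R\<close>; \<open>None\<close> is the point at infinity.\<close>

fun points :: "('a, 'b) ring_scheme \<Rightarrow> 'a weierstrass \<Rightarrow> ('a \<times> 'a) option set" where
  "points R (Weierstrass a1 a2 a3 a4 a6) =
     insert None (Some ` {(x, y). x \<in> carrier R \<and> y \<in> carrier R \<and>
       y [^]\<^bsub>R\<^esub> (2::nat) \<oplus>\<^bsub>R\<^esub> a1 \<otimes>\<^bsub>R\<^esub> x \<otimes>\<^bsub>R\<^esub> y \<oplus>\<^bsub>R\<^esub> a3 \<otimes>\<^bsub>R\<^esub> y =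
       x [^]\<^bsub>R\<^esub> (3::nat) \<oplus>\<^bsub>R\<^esub> a2 \<otimes>\<^bsub>R\<^esub> x [^]\<^bsub>R\<^esub> (2::nat) \<oplus>\<^bsub>R\<^esub> a4 \<otimes>\<^bsub>R\<^esub> x \<oplus>\<^bsub>R\<^esub> a6})"


section \<open>Good ordinary reduction\<close>

text \<open>A good model at \<open>P\<close> is a model with coefficients in the local ring at \<open>P\<close> whose discriminant is
  a unit there, so that its reduction is an elliptic curve over the residue field.\<close>

definition good_model ::
  "complex set \<Rightarrow> complex set \<Rightarrow> complex weierstrass \<Rightarrow> complex weierstrass \<Rightarrow> bool" where
  "good_model K P E E' \<longleftrightarrow>
     isomorphic_over K E E' \<and>
     set_weierstrass E' \<subseteq> carrier (local_ring K P) \<and>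
     discriminant E' \<in> Units (local_ring K P)"

definition good_reduction :: "complex set \<Rightarrow> complex set \<Rightarrow> complex weierstrass \<Rightarrow> bool" where
  "good_reduction K P E \<longleftrightarrow> (\<exists>E'. good_model K P E E')"

text \<open>The choice of the good model is immaterial: two good models differ by a change of coordinates
  over the local ring, so their reductions are isomorphic.\<close>

definition reduction :: "complex set \<Rightarrow> complex set \<Rightarrow> complex weierstrass \<Rightarrow> complex set weierstrass" where
  "reduction K P E =
     map_weierstrass (\<lambda>x. local_maximal_ideal K P +>\<^bsub>local_ring K P\<^esub> x) (SOME E'. good_model K P E E')"

definition trace_of_frobenius :: "nat \<Rightarrow> complex set \<Rightarrow> complex set \<Rightarrow> complex weierstrass \<Rightarrow> int" where
  "trace_of_frobenius p K P E =
     (int p ^ residue_degree K P + 1) - int (card (points (residue_field K P) (reduction K P E)))"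

definition good_ordinary_reduction ::
  "nat \<Rightarrow> complex set \<Rightarrow> complex set \<Rightarrow> complex weierstrass \<Rightarrow> bool" where
  "good_ordinary_reduction p K P E \<longleftrightarrow>
     good_reduction K P E \<and> \<not> int p dvd trace_of_frobenius p K P E"

definition ordinary_at :: "nat \<Rightarrow> complex set \<Rightarrow> complex weierstrass \<Rightarrow> bool" where
  "ordinary_at p K E \<longleftrightarrow> (\<forall>P\<in>primes_above p K. good_ordinary_reduction p K P E)"


section \<open>The Frey curves\<close>

definition primitive_root_of_unity :: "nat \<Rightarrow> complex \<Rightarrow> bool" where
  "primitive_root_of_unity n z \<longleftrightarrow> n > 0 \<and> z ^ n = 1 \<and> (\<forall>m. 0 < m \<and> m < n \<longrightarrow> z ^ m \<noteq> 1)"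

definition zeta_sum :: "complex \<Rightarrow> int \<Rightarrow> complex" where
  "zeta_sum z j = z powi j + z powi (- j)"

definition frey_A :: "complex \<Rightarrow> int \<times> int \<times> int \<Rightarrow> int \<Rightarrow> int \<Rightarrow> complex" where
  "frey_A z = (\<lambda>(k1, k2, k3) a b.
     (zeta_sum z k3 - zeta_sum z k2) *
     (of_int a ^ 2 + zeta_sum z k1 * of_int a * of_int b + of_int b ^ 2))"

definition frey_B :: "complex \<Rightarrow> int \<times> int \<times> int \<Rightarrow> int \<Rightarrow> int \<Rightarrow> complex" where
  "frey_B z = (\<lambda>(k1, k2, k3) a b.
     (zeta_sum z k1 - zeta_sum z k3) *
     (of_int a ^ 2 + zeta_sum z k2 * of_int a * of_int b + of_int b ^ 2))"

text \<open>\<open>Y^2 = X (X - A) (X + B) = X^3 + (B - A) X^2 - A B X\<close>\<close>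

definition frey_curve :: "complex \<Rightarrow> int \<times> int \<times> int \<Rightarrow> int \<Rightarrow> int \<Rightarrow> complex weierstrass" where
  "frey_curve z k a b =
     (let A = frey_A z k a b; B = frey_B z k a b in Weierstrass 0 (B - A) 0 (- A * B) 0)"

end

theory Submission
  imports Defs "HOL-Number_Theory.Residues"
begin

text \<open>
  Let \<open>P\<close> be a prime of \<open>K = \<rat>(\<zeta>)\<close> above 3, with local ring \<open>V\<close> and maximal ideal \<open>M\<close>.

  Good reduction. The differences of the roots \<open>0\<close>, \<open>A\<close> and \<open>- B\<close> are \<open>A\<close>, \<open>B\<close> and \<open>A + B\<close>.
  With \<open>t\<^sub>j = \<zeta>\<^sup>j + \<zeta>\<^sup>-\<^sup>j\<close>, each of them is a product of a difference \<open>t\<^sub>i - t\<^sub>j\<close> and a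
  form \<open>a\<^sup>2 + t\<^sub>j a b + b\<^sup>2 = (a + \<zeta>\<^sup>j b) (a + \<zeta>\<^sup>-\<^sup>j b)\<close>. The numbers \<open>\<zeta>\<^sup>j - 1\<close>, for \<open>j\<close> prime to \<open>r\<close>,
  and \<open>\<zeta>\<^sup>j + 1\<close> are units at \<open>P\<close>, and so is \<open>t\<^sub>i - t\<^sub>j = \<zeta>\<^sup>-\<^sup>i (\<zeta>\<^sup>i\<^sup>+\<^sup>j - 1) (\<zeta>\<^sup>i\<^sup>-\<^sup>j - 1)\<close>. Dividing \<open>a\<close> and \<open>b\<close> by
  a power of 3 only rescales the curve, so they may be taken to be not both divisible by 3, and then
  the quadratic forms are units too: a zero modulo \<open>P\<close> would make \<open>\<zeta>\<^sup>j\<close> congruent to \<open>1\<close> or \<open>- 1\<close>.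

  Ordinary reduction. In characteristic 3 a curve \<open>Y\<^sup>2 = X\<^sup>3 + c X\<^sup>2 + \<dots>\<close> is ordinary if \<open>c \<noteq> 0\<close>,
  and here \<open>c = B - A\<close> is congruent to \<open>s\<^sub>1 (a\<^sup>2 + b\<^sup>2) - s\<^sub>2 a b\<close>, where \<open>s\<^sub>1\<close> and \<open>s\<^sub>2\<close> are the first two
  elementary symmetric functions of the three \<open>t\<^sub>k\<close>. On the points \<open>(a : b)\<close> of the projective line over
  \<open>\<F>\<^sub>3\<close> this takes the values \<open>s\<^sub>1\<close> and \<open>s\<^sub>1 \<plusminus> s\<^sub>2\<close>, up to sign. Modulo 3 these values factor into
  expressions that vanish only at roots of unity of orders 1, 2, 4, 7, 8 or 26, and the order \<open>r > 7\<close> of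
  \<open>\<zeta>\<close> modulo \<open>P\<close> is a prime (\<open>hasse_123\<close>, \<open>hasse_124\<close>, \<open>hasse_notin_M\<close>).

  The criterion for ordinary reduction is proved by a direct count modulo 3
  (\<open>affine_points_not_dvd\<close>). After a translation the curve is \<open>Y\<^sup>2 = X\<^sup>3 + c X\<^sup>2 + d\<close>. For fixed \<open>Y\<close> the
  equation in \<open>1 / X\<close> is given by an additive polynomial, so the number of solutions is
  congruent to \<open>1\<close> plus the number of square roots of \<open>- c (d - Y\<^sup>2)\<close>. Summed over \<open>Y\<close>, this reduces the
  count to that of the conic \<open>W\<^sup>2 = c (Y\<^sup>2 - d)\<close>. As the cubic polynomial splits, \<open>- c d\<close> is a square, so
  the conic has a rational point, and its number of points is \<open>\<equiv> \<plusminus> 1 (mod 3)\<close>.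

  Arithmetic of \<open>K\<close>. The trace of Frobenius is defined by an arbitrary good model, so the count has to be
  carried over to every good model (\<open>good_model_count\<close>). This uses that \<open>V\<close> is integrally closed in
  \<open>K\<close>. The reason is the same one for which \<open>\<int>[\<zeta>]\<close> is maximal at 3: raising to a suitable power \<open>q\<close>
  of 3 is the identity modulo 3, while a high power of \<open>3 g\<close> is divisible by 3 if \<open>g\<close> is integral
  (\<open>integral_mem\<close>). It also yields that the residue field is finite.
\<close>

section \<open>Local rings with finite residue field of characteristic 3\<close>

locale field_subring =
  fixes V :: "'a::field set"
  assumes one_mem [simp, intro]: "1 \<in> V"
    and add_mem [simp, intro]: "x \<in> V \<Longrightarrow> y \<in> V \<Longrightarrow> x + y \<in> V"
    and uminus_mem [simp, intro]: "x \<in> V \<Longrightarrow> - x \<in> V"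
    and mult_mem [simp, intro]: "x \<in> V \<Longrightarrow> y \<in> V \<Longrightarrow> x * y \<in> V"
begin

lemma diff_mem [simp, intro]: "x \<in> V \<Longrightarrow> y \<in> V \<Longrightarrow> x - y \<in> V"
  using add_mem[of x "- y"] by simp

lemma zero_mem [simp, intro]: "0 \<in> V"
  using diff_mem[of 1 1] by simp

lemma power_mem [simp, intro]: "x \<in> V \<Longrightarrow> x ^ n \<in> V"
  by (induction n) auto

lemma of_nat_mem [simp, intro]: "of_nat n \<in> V"
  by (induction n) auto

lemma numeral_mem [simp, intro]: "numeral n \<in> V"
  using of_nat_mem[of "numeral n"] by simp

lemma of_int_mem [simp, intro]: "of_int n \<in> V"
  by (cases n rule: int_cases2) auto

lemma sum_mem: "(\<And>i. i \<in> I \<Longrightarrow> f i \<in> V) \<Longrightarrow> sum f I \<in> V"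
  by (induction I rule: infinite_finite_induct) auto

end

text \<open>
  The ring \<open>V\<close> lies in a field and contains the inverses of its elements outside \<open>M\<close>, so division by
  them is the division of the field. This is what makes it easier to compute with congruences
  modulo \<open>M\<close> than with elements of \<open>V / M\<close>: every computation is an identity of the ambient field
  with an error term that is visibly in \<open>M\<close>.
\<close>
locale char3_local_ring = field_subring V for V :: "'a::field set" +
  fixes M :: "'a set"
  assumes M_subset: "x \<in> M \<Longrightarrow> x \<in> V"
    and M_add: "x \<in> M \<Longrightarrow> y \<in> M \<Longrightarrow> x + y \<in> M"
    and M_mult: "x \<in> V \<Longrightarrow> y \<in> M \<Longrightarrow> x * y \<in> M"
    and one_notin_M: "1 \<notin> M"
    and inverse_mem: "x \<in> V \<Longrightarrow> x \<notin> M \<Longrightarrow> inverse x \<in> V"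
    and three_mem_M: "3 \<in> M"
    and finite_residues: "\<exists>F. finite F \<and> (\<forall>x\<in>V. \<exists>y\<in>F. x - y \<in> M)"
begin

lemma M_mult_right: "x \<in> M \<Longrightarrow> y \<in> V \<Longrightarrow> x * y \<in> M"
  using M_mult[of y x] by (simp add: mult.commute)

lemma zero_mem_M [simp]: "0 \<in> M"
  using M_mult[of 0 3] three_mem_M by simp

lemma M_uminus: "x \<in> M \<Longrightarrow> - x \<in> M"
  using M_mult[of "- 1" x] by simp

lemma M_uminus_iff [simp]: "- x \<in> M \<longleftrightarrow> x \<in> M"
  using M_uminus[of x] M_uminus[of "- x"] by auto

lemma M_diff: "x \<in> M \<Longrightarrow> y \<in> M \<Longrightarrow> x - y \<in> M"
  using M_add[of x "- y"] by simp

lemma M_diff_commute: "x - y \<in> M \<longleftrightarrow> y - x \<in> M"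
  using M_uminus_iff[of "x - y"] by simp

lemma M_three_mult: "x \<in> V \<Longrightarrow> 3 * x \<in> M"
  by (rule M_mult_right[OF three_mem_M])

lemma M_cong: "x - y \<in> M \<Longrightarrow> x \<in> M \<longleftrightarrow> y \<in> M"
  using M_diff[of x "x - y"] M_add[of "x - y" y] by auto

lemma M_prime:
  assumes "x \<in> V" "y \<in> V" "x * y \<in> M"
  shows "x \<in> M \<or> y \<in> M"
proof (rule ccontr)
  assume "\<not> ?thesis"
  hence x: "x \<notin> M" and y: "y \<notin> M" by simp_all
  have "x \<noteq> 0" using x by auto
  hence "y = inverse x * (x * y)" by simp
  also have "\<dots> \<in> M" by (rule M_mult[OF inverse_mem[OF assms(1) x] assms(3)])
  finally show False using y by simp
qed

lemma M_mult_iff: "x \<in> V \<Longrightarrow> y \<in> V \<Longrightarrow> x * y \<in> M \<longleftrightarrow> x \<in> M \<or> y \<in> M"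
  using M_prime[of x y] M_mult[of x y] M_mult_right[of x y] by auto

lemma M_power_iff: "x \<in> V \<Longrightarrow> n > 0 \<Longrightarrow> x ^ n \<in> M \<longleftrightarrow> x \<in> M"
proof (induction n)
  case (Suc n)
  then show ?case
    by (cases "n = 0") (auto simp: M_mult_iff)
qed auto

lemma two_notin_M: "2 \<notin> M"
proof
  assume "2 \<in> M"
  from M_diff[OF three_mem_M this] one_notin_M show False by simp
qed

lemma inverse_notin_M: "x \<in> V \<Longrightarrow> x \<notin> M \<Longrightarrow> inverse x \<notin> M"
  using M_mult[of x "inverse x"] one_notin_M by (cases "x = 0") auto

lemma divide_mem: "x \<in> V \<Longrightarrow> y \<in> V \<Longrightarrow> y \<notin> M \<Longrightarrow> x / y \<in> V"
  by (simp add: divide_inverse inverse_mem)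

lemma of_int_mem_M_iff: "of_int n \<in> M \<longleftrightarrow> 3 dvd n"
proof
  assume "3 dvd n"
  then obtain m where "n = 3 * m" by auto
  thus "of_int n \<in> M" by (simp add: M_three_mult)
next
  assume n: "of_int n \<in> M"
  show "3 dvd n"
  proof (rule ccontr)
    assume "\<not> 3 dvd n"
    hence "coprime 3 n" by (intro prime_imp_coprime) auto
    then obtain u v where "u * 3 + v * n = 1" using bezout_int[of 3 n] by auto
    hence "1 = (of_int (u * 3 + v * n) :: 'a)" by simp
    also have "\<dots> = of_int u * 3 + of_int v * of_int n" by simp
    also have "\<dots> \<in> M" using n by (intro M_add M_mult three_mem_M) auto
    finally show False using one_notin_M by simp
  qed
qed

subsection \<open>Counting residue classes\<close>

definition rep :: "'a \<Rightarrow> 'a" where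
  "rep x = (SOME y. y \<in> V \<and> y - x \<in> M)"

text \<open>A system of representatives of the residue classes.\<close>

definition T :: "'a set" where
  "T = rep ` V"

lemma rep_props: assumes "x \<in> V" shows "rep x \<in> V" "rep x - x \<in> M"
proof -
  have "\<exists>y. y \<in> V \<and> y - x \<in> M" using assms by (intro exI[of _ x]) auto
  from someI_ex[OF this] show "rep x \<in> V" "rep x - x \<in> M"
    unfolding rep_def by auto
qed

lemma rep_eqI: assumes "x - y \<in> M" shows "rep x = rep y"
proof -
  have "z - x \<in> M \<longleftrightarrow> z - y \<in> M" for z
    using M_add[of "z - x" "x - y"] M_diff[of "z - y" "x - y"] assms by auto
  thus ?thesis by (simp add: rep_def)
qed

lemma rep_eq_iff: assumes "x \<in> V" "y \<in> V" shows "rep x = rep y \<longleftrightarrow> x - y \<in> M"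
proof
  assume eq: "rep x = rep y"
  have "x - y = (rep y - y) - (rep x - x)" using eq by simp
  also have "\<dots> \<in> M" by (rule M_diff[OF rep_props(2)[OF assms(2)] rep_props(2)[OF assms(1)]])
  finally show "x - y \<in> M" .
qed (rule rep_eqI)

lemma T_subset: "x \<in> T \<Longrightarrow> x \<in> V"
  using rep_props by (auto simp: T_def)

lemma rep_mem_T: "x \<in> V \<Longrightarrow> rep x \<in> T"
  by (auto simp: T_def)

lemma rep_idem: "x \<in> T \<Longrightarrow> rep x = x"
  using rep_eqI[OF rep_props(2)] by (auto simp: T_def)

lemma T_eqI: "x \<in> T \<Longrightarrow> y \<in> T \<Longrightarrow> x - y \<in> M \<Longrightarrow> x = y"
  using rep_eqI[of x y] rep_idem by auto

lemma finite_T: "finite T"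
proof -
  obtain F where F: "finite F" "\<forall>x\<in>V. \<exists>y\<in>F. x - y \<in> M"
    using finite_residues by blast
  have "T \<subseteq> rep ` F"
  proof
    fix t assume t: "t \<in> T"
    then obtain y where "y \<in> F" "t - y \<in> M" using F T_subset by blast
    thus "t \<in> rep ` F" using rep_eqI[of t y] rep_idem[OF t] by auto
  qed
  thus ?thesis using F finite_subset by blast
qed

text \<open>The maps of \<open>V\<close> to itself that descend to the residue field.\<close>

definition compatible :: "('a \<Rightarrow> 'a) \<Rightarrow> bool" where
  "compatible f \<longleftrightarrow> (\<forall>x\<in>V. f x \<in> V) \<and> (\<forall>x\<in>V. \<forall>y\<in>V. x - y \<in> M \<longrightarrow> f x - f y \<in> M)"

lemma compatible_const: "c \<in> V \<Longrightarrow> compatible (\<lambda>x. c)"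
  and compatible_id: "compatible (\<lambda>x. x)"
  by (auto simp: compatible_def)

lemma compatible_add:
  assumes "compatible f" "compatible g" shows "compatible (\<lambda>x. f x + g x)"
  unfolding compatible_def
proof (intro conjI ballI impI)
  fix x y assume "x \<in> V" "y \<in> V" "x - y \<in> M"
  hence "f x - f y \<in> M" "g x - g y \<in> M" using assms by (auto simp: compatible_def)
  hence "(f x - f y) + (g x - g y) \<in> M" by (rule M_add)
  thus "f x + g x - (f y + g y) \<in> M" by (simp add: algebra_simps)
qed (use assms in \<open>auto simp: compatible_def\<close>)

lemma compatible_mult:
  assumes "compatible f" "compatible g" shows "compatible (\<lambda>x. f x * g x)"
  unfolding compatible_def
proof (intro conjI ballI impI)
  fix x y assume "x \<in> V" "y \<in> V" "x - y \<in> M"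
  hence "f x - f y \<in> M" "g x \<in> V" "f y \<in> V" "g x - g y \<in> M"
    using assms by (auto simp: compatible_def)
  hence "(f x - f y) * g x + f y * (g x - g y) \<in> M"
    using M_add[OF M_mult_right M_mult] by blast
  thus "f x * g x - f y * g y \<in> M" by (simp add: algebra_simps)
qed (use assms in \<open>auto simp: compatible_def\<close>)

lemma compatible_uminus: "compatible f \<Longrightarrow> compatible (\<lambda>x. - f x)"
  using compatible_mult[OF compatible_const[of "- 1"]] by simp

lemma compatible_diff: "compatible f \<Longrightarrow> compatible g \<Longrightarrow> compatible (\<lambda>x. f x - g x)"
  using compatible_add[OF _ compatible_uminus] by simp

lemma compatible_power: "compatible f \<Longrightarrow> compatible (\<lambda>x. f x ^ n)"
  by (induction n) (auto intro: compatible_const compatible_mult)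

lemmas compatible_intros =
  compatible_const compatible_id compatible_add compatible_mult compatible_uminus compatible_diff compatible_power

definition zeros :: "('a \<Rightarrow> 'a) \<Rightarrow> nat" where
  "zeros f = card {x \<in> T. f x \<in> M}"

lemma zeros_cong: "(\<And>x. x \<in> V \<Longrightarrow> f x \<in> M \<longleftrightarrow> g x \<in> M) \<Longrightarrow> zeros f = zeros g"
  unfolding zeros_def by (rule arg_cong[of _ _ card]) (use T_subset in auto)

text \<open>
  All changes of variables go through this lemma: an injective map of the finite residue field to
  itself is bijective, so it permutes the residue classes over which a count runs.
\<close>
lemma zeros_substitute:
  assumes f: "compatible f" and g: "\<And>x. x \<in> V \<Longrightarrow> g x \<in> V"
    and inj: "\<And>x y. x \<in> V \<Longrightarrow> y \<in> V \<Longrightarrow> g x - g y \<in> M \<Longrightarrow> x - y \<in> M"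
  shows "zeros (\<lambda>x. f (g x)) = zeros f"
proof -
  have inj_T: "inj_on (\<lambda>t. rep (g t)) T"
  proof (rule inj_onI)
    fix x y assume xy: "x \<in> T" "y \<in> T" "rep (g x) = rep (g y)"
    hence "g x - g y \<in> M" using rep_eq_iff[of "g x" "g y"] g T_subset by simp
    thus "x = y" using xy inj T_subset T_eqI by simp
  qed
  have range_T: "(\<lambda>t. rep (g t)) ` T = T"
    by (rule endo_inj_surj[OF finite_T _ inj_T]) (auto intro: rep_mem_T g T_subset)
  have f_iff: "f (rep y) \<in> M \<longleftrightarrow> f y \<in> M" if "y \<in> V" for y
    using M_cong[of "f (rep y)" "f y"] f rep_props[OF that] that by (auto simp: compatible_def)
  have "bij_betw (\<lambda>t. rep (g t)) {x \<in> T. f (g x) \<in> M} {x \<in> T. f x \<in> M}"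
    unfolding bij_betw_def
  proof
    show "inj_on (\<lambda>t. rep (g t)) {x \<in> T. f (g x) \<in> M}"
      by (rule inj_on_subset[OF inj_T]) auto
    have "{x \<in> T. f x \<in> M} = {x \<in> (\<lambda>t. rep (g t)) ` T. f x \<in> M}" 
      by (simp add: range_T)
    also have "\<dots> = (\<lambda>t. rep (g t)) ` {x \<in> T. f (g x) \<in> M}" 
      using f_iff[OF g[OF T_subset]] by auto
    finally show "(\<lambda>t. rep (g t)) ` {x \<in> T. f (g x) \<in> M} = {x \<in> T. f x \<in> M}" ..
  qed
  thus ?thesis
    unfolding zeros_def by (rule bij_betw_same_card)
qed

lemma zeros_shift:
  assumes "compatible f" "c \<in> V"
  shows "zeros (\<lambda>x. f (x + c)) = zeros f"
  using assms by (intro zeros_substitute[of f "\<lambda>x. x + c"]) auto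

lemma zeros_linear:
  assumes "b \<in> V"
  shows "zeros (\<lambda>x. x - b) = 1"
proof -
  have "x = rep b" if "x \<in> T" "x - b \<in> M" for x
    using rep_eqI[OF that(2)] rep_idem[OF that(1)] by simp
  hence "{x \<in> T. x - b \<in> M} = {rep b}"
    using rep_props(2)[OF assms] rep_mem_T[OF assms] by blast
  thus ?thesis by (simp add: zeros_def)
qed

lemma zeros_eq_sum: "zeros f = (\<Sum>x\<in>T. if f x \<in> M then 1 else 0)"
  by (simp add: zeros_def sum.If_cases[OF finite_T] Int_def)

lemma sum_zeros_swap: "(\<Sum>x\<in>T. zeros (\<lambda>y. f x y)) = (\<Sum>y\<in>T. zeros (\<lambda>x. f x y))"
  unfolding zeros_eq_sum by (rule sum.swap)

end

section \<open>Points on curves over a finite field of characteristic 3\<close>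

context char3_local_ring
begin

lemma zeros_union:
  assumes "\<And>x. x \<in> V \<Longrightarrow> f x \<in> M \<longleftrightarrow> g x \<in> M \<or> h x \<in> M"
    and "\<And>x. x \<in> V \<Longrightarrow> \<not> (g x \<in> M \<and> h x \<in> M)"
  shows "zeros f = zeros g + zeros h"
proof -
  have "{x \<in> T. f x \<in> M} = {x \<in> T. g x \<in> M} \<union> {x \<in> T. h x \<in> M}"
    using assms(1) T_subset by blast
  moreover have "{x \<in> T. g x \<in> M} \<inter> {x \<in> T. h x \<in> M} = {}"
    using assms(2) T_subset by blast
  ultimately show ?thesis
    by (simp add: zeros_def card_Un_disjoint finite_T)
qed

lemma zeros_pos:
  assumes "compatible f" "x \<in> V" "f x \<in> M"
  shows "zeros f > 0"
proof -
  have "f (rep x) - f x \<in> M"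
    using assms rep_props[of x] by (simp add: compatible_def)
  hence "f (rep x) \<in> M" using M_cong assms(3) by blast
  hence "rep x \<in> {t \<in> T. f t \<in> M}" using rep_mem_T assms(2) by blast
  thus ?thesis unfolding zeros_def using finite_T by (auto simp: card_gt_0_iff)
qed

lemma zeros_eq_0_iff: "zeros f = 0 \<longleftrightarrow> (\<forall>x\<in>T. f x \<notin> M)"
  using finite_T by (auto simp: zeros_def)

lemma zeros_id: "zeros (\<lambda>x. x) = 1"
  using zeros_linear[of 0] by simp

lemma zeros_affine:
  assumes "a \<in> V" "a \<notin> M" "b \<in> V"
  shows "zeros (\<lambda>x. x * a - b) = 1"
proof -
  have a: "a \<noteq> 0" using assms by auto
  have ba: "b / a \<in> V" using assms by (intro divide_mem) auto
  have "zeros (\<lambda>x. x * a - b) = zeros (\<lambda>x. x - b / a)"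
  proof (rule zeros_cong)
    fix x assume x: "x \<in> V"
    have "x * a - b = a * (x - b / a)" using a by (simp add: field_simps)
    thus "x * a - b \<in> M \<longleftrightarrow> x - b / a \<in> M" using M_mult_iff[OF assms(1), of "x - b / a"] x ba assms by auto
  qed
  thus ?thesis using zeros_linear[OF ba] by simp
qed

lemma zeros_square_minus:
  assumes "s \<in> V" "s \<notin> M"
  shows "zeros (\<lambda>x. x\<^sup>2 - s) = 0 \<or> zeros (\<lambda>x. x\<^sup>2 - s) = 2"
proof (cases "zeros (\<lambda>x. x\<^sup>2 - s) = 0")
  case False
  then obtain x0 where x0: "x0 \<in> T" "x0\<^sup>2 - s \<in> M" by (auto simp: zeros_eq_0_iff)
  have x0V: "x0 \<in> V" using x0 T_subset by simp
  have x0M: "x0 \<notin> M"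
  proof
    assume "x0 \<in> M"
    hence "x0\<^sup>2 \<in> M" using M_power_iff[OF x0V] by simp
    from M_diff[OF this x0(2)] assms show False by simp
  qed
  have "zeros (\<lambda>x. x\<^sup>2 - s) = zeros (\<lambda>x. x - x0) + zeros (\<lambda>x. x - (- x0))"
  proof (rule zeros_union)
    fix x assume x: "x \<in> V"
    have "(x\<^sup>2 - s) - (x - x0) * (x - (- x0)) = x0\<^sup>2 - s" by (simp add: algebra_simps power2_eq_square)
    hence "(x\<^sup>2 - s) - (x - x0) * (x - (- x0)) \<in> M" using x0(2) by (simp only:)
    hence "x\<^sup>2 - s \<in> M \<longleftrightarrow> (x - x0) * (x - (- x0)) \<in> M" by (rule M_cong)
    thus "x\<^sup>2 - s \<in> M \<longleftrightarrow> x - x0 \<in> M \<or> x - (- x0) \<in> M"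
      using M_mult_iff[of "x - x0" "x - (- x0)"] x x0V by simp
    show "\<not> (x - x0 \<in> M \<and> x - (- x0) \<in> M)"
    proof
      assume "x - x0 \<in> M \<and> x - (- x0) \<in> M"
      hence "(x - (- x0)) - (x - x0) \<in> M" using M_diff by blast
      hence "2 * x0 \<in> M" by (simp add: algebra_simps)
      thus False using M_mult_iff[of 2 x0] two_notin_M x0M x0V by simp
    qed
  qed
  thus ?thesis using zeros_linear[of x0] zeros_linear[of "- x0"] x0V by simp
qed auto

text \<open>
  If \<open>x\<^sub>0 \<notin> M\<close> is a root, then \<open>X\<^sup>3 + c X\<^sup>2 + d\<close> splits off the factor \<open>X - x\<^sub>0\<close> and leaves a
  quadratic polynomial whose discriminant is \<open>- c d\<close> up to squares; so the count is exact in this case.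
\<close>
lemma zeros_cubic_of_root:
  assumes c: "c \<in> V" "c \<notin> M" and d: "d \<in> V"
    and x0: "x0 \<in> V" "x0 \<notin> M" "x0 ^ 3 + c * x0\<^sup>2 + d \<in> M"
  shows "zeros (\<lambda>x. x ^ 3 + c * x\<^sup>2 + d) = 1 + zeros (\<lambda>w. w\<^sup>2 + c * d)"
proof -
  let ?q = "\<lambda>h. h\<^sup>2 + c * h - c * x0"
  have "zeros (\<lambda>x. x ^ 3 + c * x\<^sup>2 + d) = zeros (\<lambda>h. (h + x0) ^ 3 + c * (h + x0)\<^sup>2 + d)"
    using zeros_shift[of "\<lambda>x. x ^ 3 + c * x\<^sup>2 + d" x0] c d x0 by (simp add: compatible_intros)
  also have "\<dots> = zeros (\<lambda>h. h) + zeros ?q"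
  proof (rule zeros_union)
    fix h assume h: "h \<in> V"
    have "((h + x0) ^ 3 + c * (h + x0)\<^sup>2 + d) - h * ?q h
        = (x0 ^ 3 + c * x0\<^sup>2 + d) + 3 * (h\<^sup>2 * x0 + h * x0\<^sup>2 + c * h * x0)"
      by (simp add: algebra_simps power2_eq_square power3_eq_cube)
    also have "\<dots> \<in> M" by (rule M_add[OF x0(3) M_three_mult]) (use h c x0 in auto)
    finally show "(h + x0) ^ 3 + c * (h + x0)\<^sup>2 + d \<in> M \<longleftrightarrow> h \<in> M \<or> ?q h \<in> M"
      using M_cong M_mult_iff[of h "?q h"] h c x0 by auto
    show "\<not> (h \<in> M \<and> ?q h \<in> M)"
    proof
      assume H: "h \<in> M \<and> ?q h \<in> M"
      have "c * x0 = (h + c) * h - ?q h" by (simp add: algebra_simps power2_eq_square)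
      also have "\<dots> \<in> M" using H h c by (intro M_diff[OF M_mult]) auto
      finally show False using M_mult_iff[of c x0] c x0 by simp
    qed
  qed
  \<comment> \<open>In characteristic 3 the translation by \<open>c\<close> completes the square, as \<open>1 / 2 = - 1\<close>.\<close>
  also have "zeros ?q = zeros (\<lambda>h. ?q (h + c))"
    using zeros_shift[of ?q c] c x0 by (simp add: compatible_intros)
  also have "\<dots> = zeros (\<lambda>w. (w * x0)\<^sup>2 + c * d)"
  proof (rule zeros_cong)
    fix h assume h: "h \<in> V"
    have "((h * x0)\<^sup>2 + c * d) - x0\<^sup>2 * ?q (h + c)
        = c * (x0 ^ 3 + c * x0\<^sup>2 + d) - 3 * (c * h * x0\<^sup>2 + c\<^sup>2 * x0\<^sup>2)"
      by (simp add: algebra_simps power2_eq_square power3_eq_cube)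
    also have "\<dots> \<in> M" by (rule M_diff[OF M_mult[OF c(1) x0(3)] M_three_mult]) (use h c x0 in auto)
    finally show "?q (h + c) \<in> M \<longleftrightarrow> (h * x0)\<^sup>2 + c * d \<in> M"
      using M_cong M_mult_iff[of "x0\<^sup>2" "?q (h + c)"] M_power_iff[of x0 2] h c x0 by auto
  qed
  also have "\<dots> = zeros (\<lambda>w. w\<^sup>2 + c * d)"
  proof (rule zeros_substitute[where g = "\<lambda>w. w * x0"])
    fix x y assume "x \<in> V" "y \<in> V" "x * x0 - y * x0 \<in> M"
    thus "x - y \<in> M" using M_mult_iff[of "x - y" x0] x0 by (simp add: left_diff_distrib)
  qed (use c d x0 in \<open>auto intro!: compatible_intros\<close>)
  finally show ?thesis by (simp add: zeros_id)
qed

text \<open>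
  When there is no such root, \<open>- c d\<close> is a square: otherwise the additive polynomial \<open>d Z\<^sup>3 + c Z\<close>
  would be injective on the finite residue field, hence would take the value \<open>- 1\<close>, and \<open>1 / z\<close> would
  be a root.
\<close>
lemma zeros_cubic:
  assumes c: "c \<in> V" "c \<notin> M" and d: "d \<in> V"
  shows "zeros (\<lambda>x. x ^ 3 + c * x\<^sup>2 + d) mod 3 = (1 + zeros (\<lambda>w. w\<^sup>2 + c * d)) mod 3"
proof (cases "\<exists>x0\<in>V. x0 \<notin> M \<and> x0 ^ 3 + c * x0\<^sup>2 + d \<in> M")
  case True
  then obtain x0 where "x0 \<in> V" "x0 \<notin> M" "x0 ^ 3 + c * x0\<^sup>2 + d \<in> M" by blast
  from zeros_cubic_of_root[OF c d this] show ?thesis by simp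
next
  case False
  hence no_root: "x \<in> M" if "x \<in> V" "x ^ 3 + c * x\<^sup>2 + d \<in> M" for x
    using that by blast
  have dM: "d \<notin> M"
  proof
    assume "d \<in> M"
    moreover have "(- c) ^ 3 + c * (- c)\<^sup>2 + d = d" by (simp add: power2_eq_square power3_eq_cube)
    ultimately show False using no_root[of "- c"] c by simp
  qed
  have "zeros (\<lambda>x. x ^ 3 + c * x\<^sup>2 + d) = 0"
    unfolding zeros_eq_0_iff
  proof (intro ballI notI)
    fix x assume x: "x \<in> T" "x ^ 3 + c * x\<^sup>2 + d \<in> M"
    have xV: "x \<in> V" using x T_subset by simp
    have xM: "x \<in> M" using no_root[OF xV x(2)] .
    have "(x ^ 3 + c * x\<^sup>2 + d) - (x\<^sup>2 + c * x) * x \<in> M"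
      by (rule M_diff[OF x(2) M_mult[OF _ xM]]) (use xV c in auto)
    moreover have "(x ^ 3 + c * x\<^sup>2 + d) - (x\<^sup>2 + c * x) * x = d"
      by (simp add: algebra_simps power2_eq_square power3_eq_cube)
    ultimately show False using dM by simp
  qed
  moreover have "zeros (\<lambda>w. w\<^sup>2 + c * d) = 2"
  proof -
    have "zeros (\<lambda>w. w\<^sup>2 + c * d) \<noteq> 0"
    proof
      assume no_sqrt: "zeros (\<lambda>w. w\<^sup>2 + c * d) = 0"
      let ?g = "\<lambda>z. d * z ^ 3 + c * z"
      have "zeros (\<lambda>z. ?g z - (- 1)) = zeros (\<lambda>z. z - (- 1))"
      proof (rule zeros_substitute[where g = ?g])
        fix x y assume xy: "x \<in> V" "y \<in> V" "?g x - ?g y \<in> M"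
        define h where "h = x - y"
        have h: "h \<in> V" using xy by (simp add: h_def)
        have "h * (d * h\<^sup>2 + c) = (?g x - ?g y) - 3 * (d * x * y * h)"
          by (simp add: h_def algebra_simps power2_eq_square power3_eq_cube)
        also have "\<dots> \<in> M" by (rule M_diff[OF xy(3) M_three_mult]) (use h xy d in auto)
        finally have "h \<in> M \<or> d * h\<^sup>2 + c \<in> M" using h c d by (intro M_prime) auto
        moreover have "d * h\<^sup>2 + c \<notin> M"
        proof
          assume "d * h\<^sup>2 + c \<in> M"
          \<comment> \<open>A nonzero element \<open>h\<close> of the kernel would make \<open>d h\<close> a square root of \<open>- c d\<close>.\<close>
          hence "d * (d * h\<^sup>2 + c) \<in> M" by (rule M_mult[OF d])
          also have "d * (d * h\<^sup>2 + c) = (d * h)\<^sup>2 + c * d" by (simp add: algebra_simps power2_eq_square)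
          finally have "zeros (\<lambda>w. w\<^sup>2 + c * d) > 0"
            using zeros_pos[of "\<lambda>w. w\<^sup>2 + c * d" "d * h"] c d h by (simp add: compatible_intros)
          thus False using no_sqrt by simp
        qed
        ultimately show "x - y \<in> M" by (simp add: h_def)
      qed (use c d in \<open>auto intro!: compatible_intros\<close>)
      also have "\<dots> = 1" by (rule zeros_linear) auto
      finally have "zeros (\<lambda>z. ?g z - (- 1)) \<noteq> 0" by simp
      then obtain z where z: "z \<in> T" "?g z - (- 1) \<in> M" unfolding zeros_eq_0_iff by blast
      have zV: "z \<in> V" using z T_subset by simp
      have zM: "z \<notin> M"
      proof
        assume "z \<in> M"
        hence "(?g z - (- 1)) - (d * z\<^sup>2 + c) * z \<in> M" 
          using zV c d by (intro M_diff[OF z(2) M_mult]) auto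
        thus False using one_notin_M by (simp add: algebra_simps power2_eq_square power3_eq_cube)
      qed
      have z0: "z \<noteq> 0" using zM by auto
      have inv: "inverse z \<in> V" "inverse z \<notin> M"
        using zV zM by (auto intro: inverse_mem simp: inverse_notin_M)
      have "(inverse z) ^ 3 + c * (inverse z)\<^sup>2 + d = (inverse z) ^ 3 * (?g z - (- 1))"
        using z0 by (simp add: field_simps power2_eq_square power3_eq_cube)
      also have "\<dots> \<in> M" using inv by (intro M_mult z(2)) auto
      finally show False using no_root inv by blast
    qed
    thus ?thesis using zeros_square_minus[of "- (c * d)"] c d dM M_mult_iff[of c d] by auto
  qed
  ultimately show ?thesis by simp
qed

text \<open>
  The residue classes are sorted by the value \<open>b\<close> of \<open>x\<^sup>3 - x\<close>. The fibres of this additive map are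
  empty or translates of its kernel, the prime field.
\<close>
lemma three_dvd_card_T: "3 dvd card T"
proof -
  have "card T = (\<Sum>x\<in>T. zeros (\<lambda>b. b - (x ^ 3 - x)))"
    using zeros_linear T_subset by simp
  also have "\<dots> = (\<Sum>x\<in>T. zeros (\<lambda>b. x ^ 3 - x - b))"
    by (intro sum.cong zeros_cong M_diff_commute refl)
  also have "\<dots> = (\<Sum>b\<in>T. zeros (\<lambda>x. x ^ 3 - x - b))"
    by (rule sum_zeros_swap)
  also have "3 dvd \<dots>"
  proof (rule dvd_sum)
    fix b assume "b \<in> T"
    hence b: "b \<in> V" by (rule T_subset)
    show "3 dvd zeros (\<lambda>x. x ^ 3 - x - b)"
    proof (cases "zeros (\<lambda>x. x ^ 3 - x - b) = 0")
      case False
      then obtain x0 where "x0 \<in> T" and x0M: "x0 ^ 3 - x0 - b \<in> M" by (auto simp: zeros_eq_0_iff)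
      hence x0: "x0 \<in> V" using T_subset by simp
      have "zeros (\<lambda>x. x ^ 3 - x - b) = zeros (\<lambda>h. (h + x0) ^ 3 - (h + x0) - b)"
        using zeros_shift[of "\<lambda>x. x ^ 3 - x - b" x0] b x0 by (simp add: compatible_intros)
      also have "\<dots> = zeros (\<lambda>h. h) + zeros (\<lambda>h. h\<^sup>2 - 1)"
      proof (rule zeros_union)
        fix h assume h: "h \<in> V"
        have "((h + x0) ^ 3 - (h + x0) - b) - h * (h\<^sup>2 - 1) = (x0 ^ 3 - x0 - b) + 3 * (h\<^sup>2 * x0 + h * x0\<^sup>2)"
          by (simp add: algebra_simps power2_eq_square power3_eq_cube)
        also have "\<dots> \<in> M" by (rule M_add[OF x0M M_three_mult]) (use h x0 in auto)
        finally show "(h + x0) ^ 3 - (h + x0) - b \<in> M \<longleftrightarrow> h \<in> M \<or> h\<^sup>2 - 1 \<in> M"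
          using M_cong M_mult_iff[of h "h\<^sup>2 - 1"] h by auto
        show "\<not> (h \<in> M \<and> h\<^sup>2 - 1 \<in> M)"
        proof
          assume H: "h \<in> M \<and> h\<^sup>2 - 1 \<in> M"
          hence "h\<^sup>2 \<in> M" using h by (simp add: M_power_iff)
          hence "h\<^sup>2 - (h\<^sup>2 - 1) \<in> M" using H by (blast intro: M_diff)
          thus False using one_notin_M by simp
        qed
      qed
      also have "zeros (\<lambda>h. h\<^sup>2 - 1) = 2"
        using zeros_square_minus[of 1] one_notin_M zeros_pos[of "\<lambda>h. h\<^sup>2 - 1" 1]
        by (simp add: compatible_diff compatible_power compatible_id compatible_const)
      finally show ?thesis by (simp add: zeros_id numeral_3_eq_3)
    qed simp
  qed
  finally show ?thesis .
qed

text \<open>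
  The conic \<open>W\<^sup>2 - c Y\<^sup>2 = e\<^sup>2\<close> has the rational point \<open>(e, 0)\<close>. Each line \<open>Y = t (W - e)\<close> through it
  meets the conic in exactly one other point, except when \<open>c t\<^sup>2 = 1\<close>, which happens for no \<open>t\<close>
  or for two. Hence the number of points is \<open>q + 1\<close> or \<open>q - 1\<close>, where \<open>q\<close> is the order of the
  residue field, which is divisible by 3.
\<close>
lemma conic_count:
  assumes c: "c \<in> V" "c \<notin> M" and e: "e \<in> V" "e \<notin> M"
  shows "\<not> 3 dvd (\<Sum>y\<in>T. zeros (\<lambda>w. w\<^sup>2 - c * y\<^sup>2 - e\<^sup>2))"
proof -
  have "(\<Sum>y\<in>T. zeros (\<lambda>w. w\<^sup>2 - c * y\<^sup>2 - e\<^sup>2)) = (\<Sum>y\<in>T. zeros (\<lambda>w. w\<^sup>2 - w * e - c * y\<^sup>2))"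
  proof (rule sum.cong[OF refl])
    fix y assume "y \<in> T"
    hence y: "y \<in> V" by (rule T_subset)
    have "zeros (\<lambda>w. w\<^sup>2 - c * y\<^sup>2 - e\<^sup>2) = zeros (\<lambda>w. (w + e)\<^sup>2 - c * y\<^sup>2 - e\<^sup>2)"
      using zeros_shift[of "\<lambda>w. w\<^sup>2 - c * y\<^sup>2 - e\<^sup>2" e] c e y by (simp add: compatible_intros)
    also have "\<dots> = zeros (\<lambda>w. w\<^sup>2 - w * e - c * y\<^sup>2)"
    proof (rule zeros_cong[OF M_cong])
      fix w assume w: "w \<in> V"
      have "((w + e)\<^sup>2 - c * y\<^sup>2 - e\<^sup>2) - (w\<^sup>2 - w * e - c * y\<^sup>2) = 3 * (w * e)"
        by (simp add: algebra_simps power2_eq_square)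
      thus "((w + e)\<^sup>2 - c * y\<^sup>2 - e\<^sup>2) - (w\<^sup>2 - w * e - c * y\<^sup>2) \<in> M"
        using M_three_mult[OF mult_mem[OF w e(1)]] by (simp only:)
    qed
    finally show "zeros (\<lambda>w. w\<^sup>2 - c * y\<^sup>2 - e\<^sup>2) = zeros (\<lambda>w. w\<^sup>2 - w * e - c * y\<^sup>2)" .
  qed
  also have "\<dots> = (\<Sum>w\<in>T. zeros (\<lambda>y. w\<^sup>2 - w * e - c * y\<^sup>2))"
    by (rule sum_zeros_swap)
  also have "\<dots> = (\<Sum>w\<in>T. (if w \<in> M then 1 else 0) + zeros (\<lambda>t. w * (1 - c * t\<^sup>2) - e))"
  proof (rule sum.cong[OF refl])
    fix w assume "w \<in> T"
    hence w: "w \<in> V" by (rule T_subset)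
    show "zeros (\<lambda>y. w\<^sup>2 - w * e - c * y\<^sup>2) = (if w \<in> M then 1 else 0) + zeros (\<lambda>t. w * (1 - c * t\<^sup>2) - e)"
    proof (cases "w \<in> M")
      case True
      have "zeros (\<lambda>y. w\<^sup>2 - w * e - c * y\<^sup>2) = zeros (\<lambda>y. y)"
      proof (rule zeros_cong)
        fix y assume y: "y \<in> V"
        have "(w\<^sup>2 - w * e - c * y\<^sup>2) - (- (c * y\<^sup>2)) = (w - e) * w" by (simp add: algebra_simps power2_eq_square)
        also have "\<dots> \<in> M" using True w e by (intro M_mult) auto
        finally have "w\<^sup>2 - w * e - c * y\<^sup>2 \<in> M \<longleftrightarrow> - (c * y\<^sup>2) \<in> M" by (rule M_cong)
        thus "w\<^sup>2 - w * e - c * y\<^sup>2 \<in> M \<longleftrightarrow> y \<in> M"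
          using M_mult_iff[of c "y\<^sup>2"] M_power_iff[of y 2] c y by simp
      qed
      moreover have "zeros (\<lambda>t. w * (1 - c * t\<^sup>2) - e) = 0"
        unfolding zeros_eq_0_iff
      proof (intro ballI notI)
        fix t assume t: "t \<in> T" "w * (1 - c * t\<^sup>2) - e \<in> M"
        have "w * (1 - c * t\<^sup>2) \<in> M" using True c t T_subset by (intro M_mult_right) auto
        from M_diff[OF this t(2)] e show False by simp
      qed
      ultimately show ?thesis using True by (simp add: zeros_id)
    next
      case False
      have "zeros (\<lambda>y. w\<^sup>2 - w * e - c * y\<^sup>2) = zeros (\<lambda>t. w\<^sup>2 - w * e - c * (w * t)\<^sup>2)"
      proof (rule zeros_substitute[where g = "\<lambda>t. w * t", symmetric])
        fix x y assume "x \<in> V" "y \<in> V" "w * x - w * y \<in> M"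
        thus "x - y \<in> M" using M_mult_iff[of w "x - y"] w False by (simp add: right_diff_distrib)
      qed (use c w e in \<open>auto intro!: compatible_intros\<close>)
      also have "\<dots> = zeros (\<lambda>t. w * (1 - c * t\<^sup>2) - e)"
      proof (rule zeros_cong)
        fix t assume t: "t \<in> V"
        have "w\<^sup>2 - w * e - c * (w * t)\<^sup>2 = w * (w * (1 - c * t\<^sup>2) - e)"
          by (simp add: algebra_simps power2_eq_square)
        thus "w\<^sup>2 - w * e - c * (w * t)\<^sup>2 \<in> M \<longleftrightarrow> w * (1 - c * t\<^sup>2) - e \<in> M"
          using M_mult_iff[of w "w * (1 - c * t\<^sup>2) - e"] w False c e t by simp
      qed
      finally show ?thesis using False by simp
    qed
  qed
  also have "\<dots> = 1 + (\<Sum>t\<in>T. zeros (\<lambda>w. w * (1 - c * t\<^sup>2) - e))"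
    using sum_zeros_swap[of "\<lambda>w t. w * (1 - c * t\<^sup>2) - e"] zeros_id
    by (simp add: sum.distrib zeros_eq_sum)
  also have "(\<Sum>t\<in>T. zeros (\<lambda>w. w * (1 - c * t\<^sup>2) - e)) = (\<Sum>t\<in>T. if 1 - c * t\<^sup>2 \<in> M then 0 else 1)"
  proof (rule sum.cong[OF refl])
    fix t assume "t \<in> T"
    hence t: "t \<in> V" by (rule T_subset)
    show "zeros (\<lambda>w. w * (1 - c * t\<^sup>2) - e) = (if 1 - c * t\<^sup>2 \<in> M then 0 else 1)"
    proof (cases "1 - c * t\<^sup>2 \<in> M")
      case True
      have "w * (1 - c * t\<^sup>2) - e \<notin> M" if "w \<in> V" for w
        using M_diff[OF M_mult[OF that True], of "w * (1 - c * t\<^sup>2) - e"] e by auto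
      thus ?thesis using True T_subset by (simp add: zeros_eq_0_iff)
    next
      case False
      thus ?thesis using zeros_affine[of "1 - c * t\<^sup>2" e] c t e by simp
    qed
  qed
  finally have "(\<Sum>y\<in>T. zeros (\<lambda>w. w\<^sup>2 - c * y\<^sup>2 - e\<^sup>2)) + zeros (\<lambda>t. 1 - c * t\<^sup>2)
      = 1 + (\<Sum>t\<in>T. (if 1 - c * t\<^sup>2 \<in> M then 0 else 1) + (if 1 - c * t\<^sup>2 \<in> M then 1 else 0))"
    unfolding sum.distrib by (simp add: zeros_eq_sum)
  also have "\<dots> = 1 + (\<Sum>t\<in>T. 1)"
    by (intro arg_cong2[of _ _ _ _ "(+)"] sum.cong) auto
  finally have total: "(\<Sum>y\<in>T. zeros (\<lambda>w. w\<^sup>2 - c * y\<^sup>2 - e\<^sup>2)) + zeros (\<lambda>t. 1 - c * t\<^sup>2) = 1 + card T"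
    by simp
  have inv: "inverse c \<in> V" "inverse c \<notin> M"
    using c by (auto intro: inverse_mem simp: inverse_notin_M)
  have "zeros (\<lambda>t. 1 - c * t\<^sup>2) = zeros (\<lambda>t. t\<^sup>2 - inverse c)"
  proof (rule zeros_cong)
    fix t assume t: "t \<in> V"
    have "c \<noteq> 0" using c by auto
    hence "1 - c * t\<^sup>2 = - (c * (t\<^sup>2 - inverse c))" by (simp add: right_diff_distrib)
    thus "1 - c * t\<^sup>2 \<in> M \<longleftrightarrow> t\<^sup>2 - inverse c \<in> M"
      using M_mult_iff[of c "t\<^sup>2 - inverse c"] t c inv by auto
  qed
  with zeros_square_minus[OF inv] have "zeros (\<lambda>t. 1 - c * t\<^sup>2) = 0 \<or> zeros (\<lambda>t. 1 - c * t\<^sup>2) = 2"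
    by simp
  thus ?thesis using total three_dvd_card_T by presburger
qed

text \<open>
  Here \<open>c\<close>, the coefficient of \<open>X\<^sup>2\<close> after completing the square, is the Hasse invariant of the
  curve in characteristic 3. Translating \<open>X\<close> by \<open>h = c\<^sub>4 / c\<close> removes the linear term, and then
  \<open>- c\<^sup>3 d\<close> is the discriminant of the cubic polynomial. It is a square because the cubic splits,
  so the conic that remains has a rational point.
\<close>
theorem affine_points_not_dvd:
  assumes a: "a1 \<in> V" "a2 \<in> V" "a3 \<in> V" "a4 \<in> V" "a6 \<in> V"
    and e: "e1 \<in> V" "e2 \<in> V" "e3 \<in> V"
    and b2: "a1\<^sup>2 + 4 * a2 = - 4 * (e1 + e2 + e3)"
    and b4: "2 * a4 + a1 * a3 = 2 * (e1 * e2 + e1 * e3 + e2 * e3)"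
    and b6: "a3\<^sup>2 + 4 * a6 = - 4 * (e1 * e2 * e3)"
    and distinct: "e1 - e2 \<notin> M" "e1 - e3 \<notin> M" "e2 - e3 \<notin> M"
    and hasse: "e1 + e2 + e3 \<notin> M"
  shows "\<not> 3 dvd card {(x, y). x \<in> T \<and> y \<in> T \<and>
           (y\<^sup>2 + a1 * x * y + a3 * y) - (x ^ 3 + a2 * x\<^sup>2 + a4 * x + a6) \<in> M}"
proof -
  define c where "c = - (e1 + e2 + e3)"
  define c4 where "c4 = e1 * e2 + e1 * e3 + e2 * e3"
  define h where "h = c4 / c"
  define C where "C = (\<lambda>x. (x - e1) * (x - e2) * (x - e3))"
  define D where "D = (e1 - e2) * (e1 - e3) * (e2 - e3)"
  let ?d = "C h"
  have two0: "(2 :: 'a) \<noteq> 0" "(4 :: 'a) \<noteq> 0"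
    using two_notin_M M_mult_iff[of 2 2] by auto
  have four: "(4 :: 'a) \<notin> M" using two_notin_M M_mult_iff[of 2 2] by auto
  have c: "c \<in> V" "c \<notin> M" "c \<noteq> 0"
  proof -
    show "c \<in> V" "c \<notin> M" using e hasse by (auto simp: c_def simp del: minus_add_distrib)
    thus "c \<noteq> 0" by auto
  qed
  have h: "h \<in> V" using c e by (auto simp: h_def c4_def intro!: divide_mem)
  have hc: "h * c = c4" using c by (simp add: h_def)
  have D: "D \<in> V" "D \<notin> M" using e distinct by (auto simp: D_def M_mult_iff)
  have d: "?d \<in> V" using e h by (simp add: C_def)
  have "card {(x, y). x \<in> T \<and> y \<in> T \<and>
           (y\<^sup>2 + a1 * x * y + a3 * y) - (x ^ 3 + a2 * x\<^sup>2 + a4 * x + a6) \<in> M}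
      = card (SIGMA x:T. {y \<in> T. (y\<^sup>2 + a1 * x * y + a3 * y) - (x ^ 3 + a2 * x\<^sup>2 + a4 * x + a6) \<in> M})"
    by (rule arg_cong[of _ _ card]) auto
  also have "\<dots> = (\<Sum>x\<in>T. zeros (\<lambda>y. (y\<^sup>2 + a1 * x * y + a3 * y) - (x ^ 3 + a2 * x\<^sup>2 + a4 * x + a6)))"
    using finite_T by (simp add: zeros_def)
  also have "\<dots> = (\<Sum>x\<in>T. zeros (\<lambda>y. C x - y\<^sup>2))"
  proof (rule sum.cong[OF refl])
    fix x assume "x \<in> T"
    hence x: "x \<in> V" by (rule T_subset)
    let ?f = "\<lambda>y. (y\<^sup>2 + a1 * x * y + a3 * y) - (x ^ 3 + a2 * x\<^sup>2 + a4 * x + a6)"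
    define s where "s = (a1 * x + a3) / 2"
    have s: "- s \<in> V" using a x two_notin_M by (auto simp: s_def intro!: divide_mem)
    have s2: "2 * s = a1 * x + a3" using two0 by (simp add: s_def)
    have "zeros ?f = zeros (\<lambda>y. ?f (y + (- s)))"
      using zeros_shift[of ?f "- s"] a x s by (simp add: compatible_intros)
    also have "\<dots> = zeros (\<lambda>y. C x - y\<^sup>2)"
    proof (rule zeros_cong)
      fix y
      have "4 * ?f (y + (- s)) = 4 * y\<^sup>2 + 4 * (a1 * x + a3 - 2 * s) * y + (2 * s)\<^sup>2 - 2 * (2 * s) * (a1 * x + a3)
          - 4 * (x ^ 3 + a2 * x\<^sup>2 + a4 * x + a6)"
        by (simp add: algebra_simps power2_eq_square)
      also have "\<dots> = 4 * y\<^sup>2 - (4 * x ^ 3 + (a1\<^sup>2 + 4 * a2) * x\<^sup>2 + 2 * (2 * a4 + a1 * a3) * x + (a3\<^sup>2 + 4 * a6))"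
        unfolding s2 by (simp add: algebra_simps power2_eq_square)
      also have "\<dots> = 4 * - (C x - y\<^sup>2)"
        unfolding b2 b4 b6 C_def by (simp add: algebra_simps power2_eq_square power3_eq_cube)
      finally have "?f (y + (- s)) = - (C x - y\<^sup>2)" using two0 by (simp only: mult_cancel_left) simp
      thus "?f (y + (- s)) \<in> M \<longleftrightarrow> C x - y\<^sup>2 \<in> M" using M_uminus_iff by metis
    qed
    finally show "zeros ?f = zeros (\<lambda>y. C x - y\<^sup>2)" .
  qed
  also have "\<dots> = (\<Sum>y\<in>T. zeros (\<lambda>x. C x - y\<^sup>2))"
    by (rule sum_zeros_swap)
  also have "\<dots> = (\<Sum>y\<in>T. zeros (\<lambda>x. x ^ 3 + c * x\<^sup>2 + (?d - y\<^sup>2)))"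
  proof (rule sum.cong[OF refl])
    fix y assume "y \<in> T"
    hence y: "y \<in> V" by (rule T_subset)
    have "zeros (\<lambda>x. C x - y\<^sup>2) = zeros (\<lambda>x. C (x + h) - y\<^sup>2)"
      using zeros_shift[of "\<lambda>x. C x - y\<^sup>2" h] h e y unfolding C_def by (simp add: compatible_intros)
    also have "\<dots> = zeros (\<lambda>x. x ^ 3 + c * x\<^sup>2 + (?d - y\<^sup>2))"
    proof (rule zeros_cong[OF M_cong])
      fix x assume x: "x \<in> V"
      have "(C (x + h) - y\<^sup>2) - (x ^ 3 + c * x\<^sup>2 + (?d - y\<^sup>2)) = 3 * (h * x\<^sup>2 + h\<^sup>2 * x) + (2 * (h * c) + c4) * x"
        by (simp add: C_def c_def c4_def algebra_simps power2_eq_square power3_eq_cube)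
      also have "\<dots> = 3 * (h * x\<^sup>2 + h\<^sup>2 * x + c4 * x)"
        unfolding hc by (simp add: algebra_simps)
      finally show "(C (x + h) - y\<^sup>2) - (x ^ 3 + c * x\<^sup>2 + (?d - y\<^sup>2)) \<in> M"
        using M_three_mult[of "h * x\<^sup>2 + h\<^sup>2 * x + c4 * x"] x h e by (simp add: c4_def)
    qed
    finally show "zeros (\<lambda>x. C x - y\<^sup>2) = zeros (\<lambda>x. x ^ 3 + c * x\<^sup>2 + (?d - y\<^sup>2))" .
  qed
  finally have count: "card {(x, y). x \<in> T \<and> y \<in> T \<and>
           (y\<^sup>2 + a1 * x * y + a3 * y) - (x ^ 3 + a2 * x\<^sup>2 + a4 * x + a6) \<in> M}
      = (\<Sum>y\<in>T. zeros (\<lambda>x. x ^ 3 + c * x\<^sup>2 + (?d - y\<^sup>2)))" .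
  have e0: "D / c \<in> V" "D / c \<notin> M"
  proof -
    show "D / c \<in> V" using D c by (intro divide_mem) auto
    show "D / c \<notin> M" using D c M_mult[of c "D / c"] by auto
  qed
  have disc: "c * ?d + (D / c)\<^sup>2 \<in> M"
  proof -
    have "c ^ 3 * ?d = (h * c) ^ 3 + c\<^sup>2 * (h * c)\<^sup>2 + c\<^sup>2 * (h * c) * c4 - c ^ 3 * (e1 * e2 * e3)"
      by (simp add: C_def c_def c4_def algebra_simps power2_eq_square power3_eq_cube)
    also have "\<dots> = c4 ^ 3 + 2 * c\<^sup>2 * c4\<^sup>2 - c ^ 3 * (e1 * e2 * e3)"
      unfolding hc by (simp add: algebra_simps power2_eq_square)
    finally have "c ^ 3 * ?d + D\<^sup>2 = 3 * (c\<^sup>2 * c4\<^sup>2 - c4 ^ 3 + c ^ 3 * (e1 * e2 * e3)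
        - 6 * c * c4 * (e1 * e2 * e3) - 9 * (e1 * e2 * e3)\<^sup>2)"
      by (simp add: D_def c_def c4_def algebra_simps power2_eq_square power3_eq_cube)
    also have "\<dots> \<in> M" by (rule M_three_mult) (use c e in \<open>auto simp: c4_def\<close>)
    also have "c ^ 3 * ?d + D\<^sup>2 = c\<^sup>2 * (c * ?d + (D / c)\<^sup>2)"
      using c by (simp add: field_simps power2_eq_square power3_eq_cube)
    finally show ?thesis
      using M_mult_iff[of "c\<^sup>2" "c * ?d + (D / c)\<^sup>2"] M_power_iff[of c 2] c d e0 by simp
  qed
  have "(\<Sum>y\<in>T. zeros (\<lambda>x. x ^ 3 + c * x\<^sup>2 + (?d - y\<^sup>2))) mod 3
      = (\<Sum>y\<in>T. zeros (\<lambda>x. x ^ 3 + c * x\<^sup>2 + (?d - y\<^sup>2)) mod 3) mod 3"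
    by (rule mod_sum_eq[symmetric])
  also have "\<dots> = (\<Sum>y\<in>T. (1 + zeros (\<lambda>w. w\<^sup>2 - c * y\<^sup>2 - (D / c)\<^sup>2)) mod 3) mod 3"
  proof (rule arg_cong[of _ _ "\<lambda>n. n mod 3"], rule sum.cong[OF refl])
    fix y assume "y \<in> T"
    hence y: "y \<in> V" by (rule T_subset)
    have "zeros (\<lambda>w. w\<^sup>2 + c * (?d - y\<^sup>2)) = zeros (\<lambda>w. w\<^sup>2 - c * y\<^sup>2 - (D / c)\<^sup>2)"
    proof (rule zeros_cong[OF M_cong])
      fix w
      have "(w\<^sup>2 + c * (?d - y\<^sup>2)) - (w\<^sup>2 - c * y\<^sup>2 - (D / c)\<^sup>2) = c * ?d + (D / c)\<^sup>2"
        by (simp add: algebra_simps)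
      thus "(w\<^sup>2 + c * (?d - y\<^sup>2)) - (w\<^sup>2 - c * y\<^sup>2 - (D / c)\<^sup>2) \<in> M" using disc by (simp only:)
    qed
    thus "zeros (\<lambda>x. x ^ 3 + c * x\<^sup>2 + (?d - y\<^sup>2)) mod 3 = (1 + zeros (\<lambda>w. w\<^sup>2 - c * y\<^sup>2 - (D / c)\<^sup>2)) mod 3"
      using zeros_cubic[of c "?d - y\<^sup>2"] c d y by simp
  qed
  also have "\<dots> = (\<Sum>y\<in>T. 1 + zeros (\<lambda>w. w\<^sup>2 - c * y\<^sup>2 - (D / c)\<^sup>2)) mod 3"
    by (rule mod_sum_eq)
  also have "\<dots> = (card T + (\<Sum>y\<in>T. zeros (\<lambda>w. w\<^sup>2 - c * y\<^sup>2 - (D / c)\<^sup>2))) mod 3"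
    by (simp only: sum.distrib) simp
  finally have "(\<Sum>y\<in>T. zeros (\<lambda>x. x ^ 3 + c * x\<^sup>2 + (?d - y\<^sup>2))) mod 3
      = (card T + (\<Sum>y\<in>T. zeros (\<lambda>w. w\<^sup>2 - c * y\<^sup>2 - (D / c)\<^sup>2))) mod 3" .
  moreover have "\<not> 3 dvd (\<Sum>y\<in>T. zeros (\<lambda>w. w\<^sup>2 - c * y\<^sup>2 - (D / c)\<^sup>2))"
    using conic_count[OF c(1,2) e0] .
  ultimately show ?thesis
    unfolding count using three_dvd_card_T by presburger
qed

end

section \<open>Integral elements\<close>

context field_subring
begin

lemma freshman_dream:
  assumes x: "x \<in> V" and y: "y \<in> V"
  shows "\<exists>w\<in>V. (x + y) ^ (3 ^ f) = x ^ (3 ^ f) + y ^ (3 ^ f) + 3 * w"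
proof (induction f)
  case 0
  show ?case by (intro bexI[of _ 0]) auto
next
  case (Suc f)
  then obtain w where w: "w \<in> V" "(x + y) ^ (3 ^ f) = x ^ (3 ^ f) + y ^ (3 ^ f) + 3 * w" by blast
  define u where "u = x ^ (3 ^ f)"
  define v where "v = y ^ (3 ^ f)"
  have uv: "u \<in> V" "v \<in> V" using x y by (auto simp: u_def v_def)
  have cube: "a ^ (3 ^ Suc f) = (a ^ (3 ^ f)) ^ 3" for a :: 'a
    by (simp add: power_mult[symmetric] mult.commute)
  have "(x + y) ^ (3 ^ Suc f) = (u + v + 3 * w) ^ 3"
    unfolding cube by (simp add: w u_def v_def)
  also have "\<dots> = u ^ 3 + v ^ 3 + 3 * (u\<^sup>2 * v + u * v\<^sup>2 + 3 * (u + v)\<^sup>2 * w + 9 * (u + v) * w\<^sup>2 + 9 * w ^ 3)"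
    by (simp add: algebra_simps power2_eq_square power3_eq_cube)
  also have "u ^ 3 = x ^ (3 ^ Suc f)" unfolding cube u_def ..
  also have "v ^ 3 = y ^ (3 ^ Suc f)" unfolding cube v_def ..
  finally show ?case using uv w by blast
qed

end

text \<open>
  Rings in which \<open>x \<mapsto> x\<^sup>q\<close> is the identity modulo 3, such as \<open>\<int>[\<zeta>\<^sub>r]\<close> with \<open>q = 3\<^sup>f \<equiv> 1 (mod r)\<close>.
  They are reduced modulo 3, and this is all that is needed to see that they
  contain every integral element whose denominator is a power of 3.
\<close>
locale frobenius_subring = field_subring V for V :: "'a::field_char_0 set" +
  fixes q :: nat
  assumes q_ge_2: "q \<ge> 2"
    and frobenius: "x \<in> V \<Longrightarrow> \<exists>y\<in>V. x ^ q = x + 3 * y"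
begin

lemma frobenius_power: "x \<in> V \<Longrightarrow> \<exists>y\<in>V. x ^ (q ^ j) = x + 3 * y"
proof (induction j)
  case 0
  show ?case by (intro bexI[of _ 0]) auto
next
  case (Suc j)
  then obtain y where y: "y \<in> V" "x ^ (q ^ j) = x + 3 * y" by blast
  obtain y' where y': "y' \<in> V" "(x ^ (q ^ j)) ^ q = x ^ (q ^ j) + 3 * y'"
    using frobenius[of "x ^ (q ^ j)"] Suc.prems by blast
  have "x ^ (q ^ Suc j) = (x ^ (q ^ j)) ^ q"
    by (simp add: power_mult[symmetric] mult.commute)
  also have "\<dots> = x ^ (q ^ j) + 3 * y'" by (rule y')
  also have "\<dots> = x + 3 * (y + y')" by (simp add: y(2) algebra_simps)
  finally show ?case using y y' by blast
qed

text \<open>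
  A high power of \<open>3 g\<close> is divisible by 3, because the powers of \<open>g\<close> have bounded denominators. But
  it is congruent to \<open>3 g\<close> modulo 3 if the exponent is a power of \<open>q\<close>.
\<close>
lemma almost_integral_mem:
  assumes g: "3 * g \<in> V" and bounded: "\<And>N. 3 ^ D * g ^ N \<in> V"
  shows "g \<in> V"
proof -
  define N where "N = q ^ D"
  have "D < 2 ^ D" by (rule less_exp)
  also have "(2 :: nat) ^ D \<le> N" using q_ge_2 by (auto simp: N_def intro: power_mono)
  finally have N: "N = Suc (N - D - 1) + D" by simp
  obtain y where y: "y \<in> V" "(3 * g) ^ N = 3 * g + 3 * y"
    using frobenius_power[OF g] unfolding N_def by blast
  have "(3 * g) ^ N = 3 ^ N * g ^ N" by (rule power_mult_distrib)
  also have "(3 :: 'a) ^ N = 3 * 3 ^ (N - D - 1) * 3 ^ D"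
    by (subst N) (simp add: power_add)
  finally have "3 * g + 3 * y = 3 * (3 ^ (N - D - 1) * (3 ^ D * g ^ N))"
    unfolding y(2) mult.assoc .
  hence "3 * g = 3 * (3 ^ (N - D - 1) * (3 ^ D * g ^ N) - y)"
    by (simp add: algebra_simps)
  hence "g = 3 ^ (N - D - 1) * (3 ^ D * g ^ N) - y"
    using mult_cancel_left[of "3 :: 'a"] by (metis zero_neq_numeral)
  also have "\<dots> \<in> V" by (intro diff_mem mult_mem[OF _ bounded] y(1)) auto
  finally show ?thesis .
qed

lemma integral_bounded_denominators:
  assumes p: "lead_coeff p = 1" "\<And>i. coeff p i \<in> V" "poly p x = 0" and x: "3 ^ k * x \<in> V"
  shows "3 ^ (k * degree p) * x ^ N \<in> V"
proof (induction N rule: less_induct)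
  case (less N)
  define n where "n = degree p"
  show ?case
  proof (cases "N < n")
    case True
    hence "k * n = k * (n - N) + k * N" by (simp flip: add_mult_distrib2)
    hence "3 ^ (k * n) * x ^ N = 3 ^ (k * (n - N)) * (3 ^ k * x) ^ N"
      by (simp add: power_add power_mult power_mult_distrib)
    also have "\<dots> \<in> V" by (intro mult_mem[OF _ power_mem[OF x]]) auto
    finally show ?thesis by (simp add: n_def)
  next
    case False
    have "(\<Sum>i\<le>n. coeff p i * x ^ i) = 0" using p(3) by (simp add: poly_altdef n_def)
    also have "(\<Sum>i\<le>n. coeff p i * x ^ i) = (\<Sum>i<n. coeff p i * x ^ i) + x ^ n"
      using p(1) by (simp add: n_def lessThan_Suc_atMost[symmetric])
    finally have xn: "x ^ n = - (\<Sum>i<n. coeff p i * x ^ i)" by (simp add: eq_neg_iff_add_eq_0 add.commute)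
    have "x ^ N = x ^ (N - n) * x ^ n" using False by (simp flip: power_add)
    also have "\<dots> = - (\<Sum>i<n. coeff p i * x ^ (N - n + i))"
      unfolding xn by (simp add: sum_distrib_left power_add mult_ac)
    finally have "3 ^ (k * n) * x ^ N = - (\<Sum>i<n. coeff p i * (3 ^ (k * n) * x ^ (N - n + i)))"
      by (simp add: sum_distrib_left mult_ac)
    also have "\<dots> \<in> V"
      by (intro uminus_mem sum_mem mult_mem p(2) less.IH[folded n_def]) (use False in auto)
    finally show ?thesis by (simp add: n_def)
  qed
qed

text \<open>
  Powers of 3 are removed from the denominator one at a time; the bound on the denominators of
  the powers of \<open>x\<close> serves for all the multiples \<open>3\<^sup>j x\<close>.
\<close>
theorem integral_mem:
  assumes p: "lead_coeff p = 1" "\<And>i. coeff p i \<in> V" "poly p x = 0" and x: "3 ^ k * x \<in> V"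
  shows "x \<in> V"
proof -
  have "3 ^ (k - j) * x \<in> V" if "j \<le> k" for j
    using that
  proof (induction j)
    case (Suc j)
    show ?case
    proof (rule almost_integral_mem)
      have "Suc (k - Suc j) = k - j" using Suc.prems by simp
      hence "3 ^ (k - j) = (3 * 3 ^ (k - Suc j) :: 'a)" by (metis power_Suc)
      hence "3 * (3 ^ (k - Suc j) * x) = 3 ^ (k - j) * x" by simp
      moreover have "3 ^ (k - j) * x \<in> V" using Suc by simp
      ultimately show "3 * (3 ^ (k - Suc j) * x) \<in> V" by (simp only:)
      show "3 ^ (k * degree p) * (3 ^ (k - Suc j) * x) ^ N \<in> V" for N
        using mult_mem[OF power_mem[of "3 ^ (k - Suc j)" N] integral_bounded_denominators[OF p x, of N]]
        by (simp add: power_mult_distrib mult_ac)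
    qed
  qed (use x in simp)
  from this[of k] show ?thesis by simp
qed

end


section \<open>The cyclotomic ring\<close>

text \<open>The Horner form makes all the closure properties of \<open>\<int>[z]\<close> inductions over one argument.\<close>

inductive_set int_adjoin :: "complex \<Rightarrow> complex set" for z where
  zero: "0 \<in> int_adjoin z"
| horner: "x \<in> int_adjoin z \<Longrightarrow> of_int a + z * x \<in> int_adjoin z"

lemma int_adjoin_of_int: "of_int a \<in> int_adjoin z"
  using int_adjoin.horner[OF int_adjoin.zero, of a z] by simp

lemma int_adjoin_self: "z \<in> int_adjoin z"
  using int_adjoin.horner[OF int_adjoin_of_int[of 1], of 0 z] by simp

lemma int_adjoin_add:
  assumes "x \<in> int_adjoin z" "y \<in> int_adjoin z"
  shows "x + y \<in> int_adjoin z"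
  using assms
proof (induction arbitrary: y rule: int_adjoin.induct)
  case (horner x a)
  show ?case
    using horner.prems
  proof cases
    case zero
    thus ?thesis using horner by (simp add: int_adjoin.horner)
  next
    case (horner y' b)
    have "of_int (a + b) + z * (x + y') \<in> int_adjoin z"
      using horner(2) by (intro int_adjoin.horner horner.IH)
    thus ?thesis using horner(1) by (simp add: algebra_simps)
  qed
qed simp

lemma int_adjoin_int_mult: "x \<in> int_adjoin z \<Longrightarrow> of_int c * x \<in> int_adjoin z"
proof (induction rule: int_adjoin.induct)
  case (horner x a)
  from int_adjoin.horner[OF horner.IH, of "c * a"] show ?case by (simp add: algebra_simps)
qed (simp add: int_adjoin.zero)

lemma int_adjoin_mult:
  assumes "x \<in> int_adjoin z" "y \<in> int_adjoin z"
  shows "x * y \<in> int_adjoin z"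
  using assms
proof (induction rule: int_adjoin.induct)
  case (horner x a)
  have "of_int a * y + (of_int 0 + z * (x * y)) \<in> int_adjoin z"
    using horner by (intro int_adjoin_add int_adjoin_int_mult int_adjoin.horner) auto
  thus ?case by (simp add: algebra_simps)
qed (simp add: int_adjoin.zero)

lemma field_subring_int_adjoin: "field_subring (int_adjoin z)"
proof
  show "1 \<in> int_adjoin z" using int_adjoin_of_int[of 1] by simp
  show "- x \<in> int_adjoin z" if "x \<in> int_adjoin z" for x
    using int_adjoin_int_mult[OF that, of "- 1"] by simp
qed (auto intro: int_adjoin_add int_adjoin_mult)

lemma int_adjoin_least:
  assumes "field_subring V" "z \<in> V" "x \<in> int_adjoin z"
  shows "x \<in> V"
proof -
  interpret field_subring V by fact
  show ?thesis using assms(3,2) by (induction rule: int_adjoin.induct) auto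
qed

lemma int_adjoin_root_of_unity:
  assumes "z ^ Suc m = 1" "x \<in> int_adjoin z"
  shows "\<exists>c :: nat \<Rightarrow> int. x = (\<Sum>i<Suc m. of_int (c i) * z ^ i)"
  using assms(2)
proof (induction rule: int_adjoin.induct)
  case zero
  show ?case by (rule exI[of _ "\<lambda>_. 0"]) simp
next
  case (horner x a)
  then obtain c where c: "x = (\<Sum>i<Suc m. of_int (c i) * z ^ i)" by blast
  define c' where "c' = (\<lambda>i. case i of 0 \<Rightarrow> a + c m | Suc j \<Rightarrow> c j)"
  have "(\<Sum>i<Suc m. of_int (c' i) * z ^ i) = of_int (a + c m) + (\<Sum>i<m. of_int (c i) * z ^ Suc i)"
    by (subst sum.lessThan_Suc_shift) (simp add: c'_def)
  also have "\<dots> = of_int a + ((\<Sum>i<m. of_int (c i) * z ^ Suc i) + of_int (c m) * z ^ Suc m)"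
    by (simp only: assms(1)) simp
  also have "\<dots> = of_int a + z * x"
    unfolding c by (simp add: sum_distrib_left algebra_simps)
  finally show ?case by metis
qed

text \<open>
  The first set is the localization \<open>\<int>[z]\<^sub>(\<^sub>3\<^sub>)\<close>. The second one is \<open>\<rat>[z]\<close>, which is
  a field if \<open>z\<close> is algebraic.
\<close>

definition int_adjoin_at_3 :: "complex \<Rightarrow> complex set" where
  "int_adjoin_at_3 z = {x. \<exists>m :: int. \<not> 3 dvd m \<and> of_int m * x \<in> int_adjoin z}"

definition int_adjoin_fractions :: "complex \<Rightarrow> complex set" where
  "int_adjoin_fractions z = {x. \<exists>m :: int. m \<noteq> 0 \<and> of_int m * x \<in> int_adjoin z}"

lemma prime_3_int: "prime (3 :: int)"
  by simp

lemma three_dvd_int_mult_iff: "3 dvd m * n \<longleftrightarrow> 3 dvd m \<or> 3 dvd (n :: int)"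
  using prime_dvd_mult_iff[OF prime_3_int] .

lemma field_subring_denominators:
  assumes one: "Q 1" and mult: "\<And>m n :: int. Q m \<Longrightarrow> Q n \<Longrightarrow> Q (m * n)"
  shows "field_subring {x. \<exists>m :: int. Q m \<and> of_int m * x \<in> int_adjoin z}"
proof -
  interpret Z: field_subring "int_adjoin z" by (rule field_subring_int_adjoin)
  show ?thesis
  proof (standard, unfold mem_Collect_eq)
    show "\<exists>m. Q m \<and> of_int m * 1 \<in> int_adjoin z" using one by (intro exI[of _ 1]) auto
  next
    fix x assume "\<exists>m. Q m \<and> of_int m * x \<in> int_adjoin z"
    then obtain m where m: "Q m" "of_int m * x \<in> int_adjoin z" by blast
    thus "\<exists>m. Q m \<and> of_int m * - x \<in> int_adjoin z" by (intro exI[of _ m]) auto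
  next
    fix x y assume "\<exists>m. Q m \<and> of_int m * x \<in> int_adjoin z" "\<exists>m. Q m \<and> of_int m * y \<in> int_adjoin z"
    then obtain m n where m: "Q m" "of_int m * x \<in> int_adjoin z" and n: "Q n" "of_int n * y \<in> int_adjoin z"
      by blast
    have "of_int n * (of_int m * x) + of_int m * (of_int n * y) \<in> int_adjoin z"
      by (rule Z.add_mem[OF Z.mult_mem[OF Z.of_int_mem m(2)] Z.mult_mem[OF Z.of_int_mem n(2)]])
    thus "\<exists>m. Q m \<and> of_int m * (x + y) \<in> int_adjoin z"
      using mult[OF m(1) n(1)] by (intro exI[of _ "m * n"]) (simp add: algebra_simps)
    have "(of_int m * x) * (of_int n * y) \<in> int_adjoin z"
      by (rule Z.mult_mem[OF m(2) n(2)])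
    thus "\<exists>m. Q m \<and> of_int m * (x * y) \<in> int_adjoin z"
      using mult[OF m(1) n(1)] by (intro exI[of _ "m * n"]) (simp add: algebra_simps)
  qed
qed

lemma field_subring_int_adjoin_at_3: "field_subring (int_adjoin_at_3 z)"
  unfolding int_adjoin_at_3_def
  by (rule field_subring_denominators[where Q = "\<lambda>m. \<not> 3 dvd m"]) (auto simp: three_dvd_int_mult_iff)

lemma field_subring_int_adjoin_fractions: "field_subring (int_adjoin_fractions z)"
  unfolding int_adjoin_fractions_def
  by (rule field_subring_denominators[where Q = "\<lambda>m. m \<noteq> 0"]) auto

lemma int_adjoin_fractions_divide:
  assumes "x \<in> int_adjoin_fractions z" "m \<noteq> 0"
  shows "x / of_int m \<in> int_adjoin_fractions z"
proof -
  from assms obtain n where n: "n \<noteq> 0" "of_int n * x \<in> int_adjoin z"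
    by (auto simp: int_adjoin_fractions_def)
  have "of_int (n * m) * (x / of_int m) = of_int n * x" using assms by simp
  thus ?thesis using n assms unfolding int_adjoin_fractions_def
    by (intro CollectI exI[of _ "n * m"]) auto
qed

lemma three_power_mult_mem_at_3:
  assumes "x \<in> int_adjoin_fractions z"
  shows "\<exists>k. 3 ^ k * x \<in> int_adjoin_at_3 z"
proof -
  from assms obtain m where m: "m \<noteq> 0" "of_int m * x \<in> int_adjoin z"
    by (auto simp: int_adjoin_fractions_def)
  obtain n where n: "m = 3 ^ multiplicity 3 m * n" "\<not> 3 dvd n"
    using multiplicity_decompose'[of m 3] m(1) by (auto simp: mult.commute)
  have "of_int n * (3 ^ multiplicity 3 m * x) = of_int (3 ^ multiplicity 3 m * n) * x"
    by (simp add: mult_ac)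
  also have "\<dots> \<in> int_adjoin z" using m(2) n(1) by simp
  finally show ?thesis using n(2) unfolding int_adjoin_at_3_def by blast
qed

text \<open>
  Multiplication by \<open>y \<noteq> 0\<close> acts on the finite-dimensional \<open>\<rat>\<close>-algebra \<open>\<rat>[z]\<close>, so the powers of
  \<open>y\<close> satisfy a linear relation, and its lowest coefficient is a multiple of \<open>y\<close>.
\<close>
lemma inverse_int_adjoin:
  assumes z: "z ^ Suc m = 1" and y: "y \<in> int_adjoin z" "y \<noteq> 0"
  shows "inverse y \<in> int_adjoin_fractions z"
proof -
  interpret Z: field_subring "int_adjoin z" by (rule field_subring_int_adjoin)
  interpret F: field_subring "int_adjoin_fractions z" by (rule field_subring_int_adjoin_fractions)
  interpret Q: vector_space "\<lambda>(a :: rat) (x :: complex). of_rat a * x"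
    by unfold_locales (auto simp: algebra_simps of_rat_add of_rat_mult)
  have sub: "x \<in> int_adjoin_fractions z" if "x \<in> int_adjoin z" for x
    using that unfolding int_adjoin_fractions_def by (intro CollectI exI[of _ 1]) auto
  have rat: "of_rat a \<in> int_adjoin_fractions z" for a
  proof -
    obtain p q where pq: "quotient_of a = (p, q)" by (cases "quotient_of a")
    hence "q > 0" "a = of_int p / of_int q"
      by (auto intro: quotient_of_denom_pos quotient_of_div)
    thus ?thesis using int_adjoin_fractions_divide[of "of_int p" z q] by (simp add: of_rat_divide)
  qed
  have span: "int_adjoin z \<subseteq> Q.span ((\<lambda>i. z ^ i) ` {..<Suc m})"
  proof
    fix x assume "x \<in> int_adjoin z"
    then obtain c :: "nat \<Rightarrow> int" where x: "x = (\<Sum>i<Suc m. of_rat (of_int (c i)) * z ^ i)"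
      using int_adjoin_root_of_unity[OF z] by fastforce
    show "x \<in> Q.span ((\<lambda>i. z ^ i) ` {..<Suc m})"
      unfolding x by (rule Q.span_sum, rule Q.span_scale, rule Q.span_base, rule imageI)
  qed
  show ?thesis
  proof (cases "inj_on (\<lambda>i. y ^ i) {..Suc m}")
    case False
    then obtain i j where ij: "y ^ i = y ^ j" "i < j"
      unfolding inj_on_def by (metis linorder_neqE_nat)
    have "y ^ j = y ^ i * (y * y ^ (j - i - 1))"
      using ij(2) by (simp flip: power_Suc power_add)
    hence "y * y ^ (j - i - 1) = 1" using ij(1) y(2) by simp
    hence "inverse y = y ^ (j - i - 1)" by (rule inverse_unique)
    thus ?thesis using y sub by simp
  next
    case True
    let ?S = "(\<lambda>i. y ^ i) ` {..Suc m}"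
    have "Q.dependent ?S"
    proof (rule ccontr)
      assume "Q.independent ?S"
      hence "card ?S \<le> card ((\<lambda>i. z ^ i) ` {..<Suc m})"
        using Q.independent_span_bound[of "(\<lambda>i. z ^ i) ` {..<Suc m}" ?S] span y by auto
      also have "\<dots> \<le> Suc m" using card_image_le[of "{..<Suc m}"] by simp
      finally show False using card_image[OF True] by simp
    qed
    then obtain u v where u: "v \<in> ?S" "u v \<noteq> 0" "(\<Sum>v\<in>?S. of_rat (u v) * v) = 0"
      using Q.dependent_finite[of ?S] by auto
    define c where "c = (\<lambda>i. u (y ^ i))"
    have c: "(\<Sum>i\<le>Suc m. of_rat (c i) * y ^ i) = 0"
      using u(3) by (subst (asm) sum.reindex[OF True]) (simp add: c_def)
    define k where "k = (LEAST i. c i \<noteq> 0)"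
    from u obtain i where i: "i \<le> Suc m" "c i \<noteq> 0" by (auto simp: c_def)
    have ck: "c k \<noteq> 0" unfolding k_def by (rule LeastI[of _ i]) (rule i)
    have k: "k \<le> Suc m" using i Least_le[of "\<lambda>i. c i \<noteq> 0" i] by (simp add: k_def)
    have below: "c j = 0" if "j < k" for j using not_less_Least[of j "\<lambda>i. c i \<noteq> 0"] that by (auto simp: k_def)
    define w where "w = (\<Sum>i\<in>{Suc k..Suc m}. of_rat (c i) * y ^ (i - Suc k))"
    have w: "w \<in> int_adjoin_fractions z"
      unfolding w_def using rat sub y by (intro F.sum_mem F.mult_mem F.power_mem) auto
    have "{..Suc m} = {..<k} \<union> insert k {Suc k..Suc m}" using k by auto
    hence "(\<Sum>i\<le>Suc m. of_rat (c i) * y ^ i)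
        = (\<Sum>i<k. of_rat (c i) * y ^ i) + (\<Sum>i\<in>insert k {Suc k..Suc m}. of_rat (c i) * y ^ i)"
      by (simp only: ) (rule sum.union_disjoint, auto)
    also have "\<dots> = of_rat (c k) * y ^ k + (\<Sum>i\<in>{Suc k..Suc m}. of_rat (c i) * y ^ i)"
      using below by simp
    also have "(\<Sum>i\<in>{Suc k..Suc m}. of_rat (c i) * y ^ i) = (\<Sum>i\<in>{Suc k..Suc m}. y ^ Suc k * (of_rat (c i) * y ^ (i - Suc k)))"
    proof (rule sum.cong[OF refl])
      fix i assume "i \<in> {Suc k..Suc m}"
      hence "y ^ i = y ^ Suc k * y ^ (i - Suc k)" using power_add[of y "Suc k" "i - Suc k"] by simp
      thus "of_rat (c i) * y ^ i = y ^ Suc k * (of_rat (c i) * y ^ (i - Suc k))" by simp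
    qed
    also have "\<dots> = y ^ Suc k * w" unfolding w_def sum_distrib_left ..
    finally have "y ^ k * (of_rat (c k) + y * w) = 0" using c by (simp add: algebra_simps)
    hence "of_rat (c k) + y * w = 0" using y by simp
    hence "- (y * w) = of_rat (c k)" by (metis add_eq_0_iff2)
    hence "y * (- w * of_rat (inverse (c k))) = of_rat (c k) * of_rat (inverse (c k))"
      by (metis minus_mult_commute minus_mult_right mult.assoc)
    also have "\<dots> = 1" using ck by (simp flip: of_rat_mult)
    finally have "y * (- w * of_rat (inverse (c k))) = 1" .
    hence "inverse y = - w * of_rat (inverse (c k))" by (rule inverse_unique)
    thus ?thesis using w rat by simp
  qed
qed

lemma complex_ring_simps:
  "carrier (ring_of_type_algebra :: complex ring) = UNIV"
  "x \<oplus>\<^bsub>(ring_of_type_algebra :: complex ring)\<^esub> y = x + y"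
  "x \<otimes>\<^bsub>(ring_of_type_algebra :: complex ring)\<^esub> y = x * y"
  "\<zero>\<^bsub>(ring_of_type_algebra :: complex ring)\<^esub> = 0"
  "\<one>\<^bsub>(ring_of_type_algebra :: complex ring)\<^esub> = 1"
  by (simp_all add: ring_of_type_algebra_def)

lemma complex_ring_a_inv: "\<ominus>\<^bsub>(ring_of_type_algebra :: complex ring)\<^esub> x = - x"
proof -
  interpret R: field "ring_of_type_algebra :: complex ring" by (rule field_from_type_algebra)
  show ?thesis by (rule R.minus_equality) (auto simp: complex_ring_simps)
qed

lemma complex_ring_m_inv: "x \<noteq> 0 \<Longrightarrow> inv\<^bsub>(ring_of_type_algebra :: complex ring)\<^esub> x = inverse x"
proof -
  interpret R: field "ring_of_type_algebra :: complex ring" by (rule field_from_type_algebra)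
  show "x \<noteq> 0 \<Longrightarrow> ?thesis" by (rule R.comm_inv_char) (auto simp: complex_ring_simps)
qed

lemma field_subring_adjoin_rat: "field_subring (adjoin_rat z)"
  unfolding adjoin_rat_def
proof
  let ?R = "ring_of_type_algebra :: complex ring"
  show "1 \<in> generate_field ?R {z}"
    using generate_field.one[of ?R "{z}"] by (simp add: complex_ring_simps)
  fix x y assume x: "x \<in> generate_field ?R {z}"
  show "- x \<in> generate_field ?R {z}"
    using generate_field.a_inv[OF x] by (simp add: complex_ring_a_inv)
  assume y: "y \<in> generate_field ?R {z}"
  show "x + y \<in> generate_field ?R {z}" "x * y \<in> generate_field ?R {z}"
    using generate_field.eng_add[OF x y] generate_field.eng_mult[OF x y]
    by (simp_all add: complex_ring_simps)
qed

lemma adjoin_rat_self: "z \<in> adjoin_rat z"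
  unfolding adjoin_rat_def by (rule generate_field.incl) simp

lemma adjoin_rat_inverse:
  assumes "x \<in> adjoin_rat z"
  shows "inverse x \<in> adjoin_rat z"
proof (cases "x = 0")
  case False
  thus ?thesis
    using generate_field.m_inv[of x "ring_of_type_algebra :: complex ring" "{z}"] assms
    by (simp add: adjoin_rat_def complex_ring_simps complex_ring_m_inv)
qed (use assms in simp)

lemma adjoin_rat_subset_fractions:
  assumes z: "z ^ Suc m = 1" and x: "x \<in> adjoin_rat z"
  shows "x \<in> int_adjoin_fractions z"
proof -
  interpret F: field_subring "int_adjoin_fractions z" by (rule field_subring_int_adjoin_fractions)
  show ?thesis
    using x unfolding adjoin_rat_def
  proof (induction rule: generate_field.induct)
    case (incl h)
    thus ?case using int_adjoin_self[of z]
      unfolding int_adjoin_fractions_def by (intro CollectI exI[of _ 1]) auto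
  next
    case (m_inv h)
    hence h0: "h \<noteq> 0" by (simp add: complex_ring_simps)
    from m_inv.IH obtain n where n: "n \<noteq> 0" "of_int n * h \<in> int_adjoin z"
      by (auto simp: int_adjoin_fractions_def)
    have "inverse h = of_int n * inverse (of_int n * h)" using n h0 by simp
    also have "\<dots> \<in> int_adjoin_fractions z"
      using n h0 by (intro F.mult_mem inverse_int_adjoin[OF z]) auto
    finally show ?case using h0 by (simp add: complex_ring_m_inv)
  qed (auto simp: complex_ring_simps complex_ring_a_inv)
qed

text \<open>
  Freshman's dream reduces the claim to \<open>z\<close> and to the integers, where it is \<open>z ^ q = z\<close> and
  Fermat's little theorem for the prime 3.
\<close>
lemma frobenius_int_adjoin:
  assumes z: "z ^ (3 ^ f) = z" and x: "x \<in> int_adjoin z"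
  shows "\<exists>w\<in>int_adjoin z. x ^ (3 ^ f) = x + 3 * w"
proof -
  interpret Z: field_subring "int_adjoin z" by (rule field_subring_int_adjoin)
  have int: "\<exists>b :: int. a ^ (3 ^ f) = a + 3 * b" for a :: int
  proof -
    have cube: "[a ^ 3 = a] (mod 3)" for a :: int
    proof -
      have "a ^ 3 - a = (a - 1) * a * (a + 1)" by (simp add: algebra_simps power3_eq_cube)
      moreover have "3 dvd (a - 1) * a * (a + 1)"
        unfolding three_dvd_int_mult_iff by presburger
      ultimately show ?thesis by (simp add: cong_iff_dvd_diff)
    qed
    have "[a ^ (3 ^ f) = a] (mod 3)"
    proof (induction f)
      case (Suc f)
      have "a ^ (3 ^ Suc f) = (a ^ (3 ^ f)) ^ 3" by (simp add: power_mult[symmetric] mult.commute)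
      with cong_trans[OF cube[of "a ^ (3 ^ f)"] Suc] show ?case by simp
    qed simp
    hence "3 dvd a ^ (3 ^ f) - a" by (simp add: cong_iff_dvd_diff)
    then obtain b where "a ^ (3 ^ f) - a = 3 * b" by auto
    thus ?thesis by (intro exI[of _ b]) simp
  qed
  show ?thesis using x
  proof (induction rule: int_adjoin.induct)
    case zero
    show ?case by (intro bexI[of _ 0]) (auto simp: power_0_left)
  next
    case (horner x a)
    then obtain w where w: "w \<in> int_adjoin z" "x ^ (3 ^ f) = x + 3 * w" by blast
    obtain b where b: "a ^ (3 ^ f) = a + 3 * b" using int by blast
    have "z * x \<in> int_adjoin z" using horner int_adjoin_self by auto
    then obtain v where v: "v \<in> int_adjoin z"
      "(of_int a + z * x) ^ (3 ^ f) = of_int a ^ (3 ^ f) + (z * x) ^ (3 ^ f) + 3 * v"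
      using Z.freshman_dream[of "of_int a" "z * x" f] by auto
    have "(of_int a :: complex) ^ (3 ^ f) = of_int (a ^ (3 ^ f))" by simp
    also have "\<dots> = of_int a + 3 * of_int b" unfolding b by simp
    finally have "(of_int a + z * x) ^ (3 ^ f) = of_int a + z * x + 3 * (of_int b + z * w + v)"
      unfolding v power_mult_distrib z w(2) by (simp add: algebra_simps)
    moreover have "of_int b + z * w + v \<in> int_adjoin z"
      using w v int_adjoin_self by auto
    ultimately show ?case by blast
  qed
qed

text \<open>
  If \<open>x = w / s\<close>, then \<open>w\<^sup>q \<equiv> w\<close> and \<open>s\<^sup>q \<equiv> s\<close> modulo 3 give \<open>x\<^sup>q \<equiv> x\<close>, as \<open>s\<close> is invertible.
\<close>
lemma frobenius_subring_localization:
  assumes "frobenius_subring W q" "field_subring V" "\<And>x. x \<in> W \<Longrightarrow> x \<in> V"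
    and "\<And>x. x \<in> V \<Longrightarrow> \<exists>s\<in>W. inverse s \<in> V \<and> s \<noteq> 0 \<and> s * x \<in> W"
  shows "frobenius_subring V q"
proof -
  interpret W: frobenius_subring W q by fact
  interpret V: field_subring V by fact
  show ?thesis
  proof
    show "q \<ge> 2" by (rule W.q_ge_2)
    fix x assume x: "x \<in> V"
    then obtain s where s: "s \<in> W" "inverse s \<in> V" "s \<noteq> 0" "s * x \<in> W" using assms(4) by blast
    obtain v where v: "v \<in> W" "(s * x) ^ q = s * x + 3 * v" using W.frobenius[OF s(4)] by blast
    obtain t where t: "t \<in> W" "s ^ q = s + 3 * t" using W.frobenius[OF s(1)] by blast
    have "s ^ q * x ^ q = s * x + 3 * v" using v by (simp add: power_mult_distrib)
    hence "s ^ q * (x ^ q - x) = 3 * (v - t * x)" by (simp add: right_diff_distrib t algebra_simps)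
    hence "x ^ q - x = inverse s ^ q * (3 * (v - t * x))"
      using s(3) by (simp add: field_simps)
    hence "x ^ q = x + 3 * (inverse s ^ q * (v - t * x))" by (simp add: algebra_simps)
    moreover have "inverse s ^ q * (v - t * x) \<in> V" using s x v t assms(3) by auto
    ultimately show "\<exists>y\<in>V. x ^ q = x + 3 * y" by blast
  qed
qed

section \<open>The residue field as an algebraic structure\<close>

lemma subring_of_complex_simps:
  "carrier (subring_of_complex S) = S"
  "x \<oplus>\<^bsub>subring_of_complex S\<^esub> y = x + y"
  "x \<otimes>\<^bsub>subring_of_complex S\<^esub> y = x * y"
  "\<zero>\<^bsub>subring_of_complex S\<^esub> = 0"
  "\<one>\<^bsub>subring_of_complex S\<^esub> = 1"
  by (simp_all add: subring_of_complex_def ring_of_type_algebra_def)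

lemma subring_of_complex_pow: "x [^]\<^bsub>subring_of_complex S\<^esub> (n :: nat) = x ^ n"
  by (induction n) (simp_all add: subring_of_complex_simps nat_pow_def)

lemma cring_subring_of_complex:
  assumes "field_subring V"
  shows "cring (subring_of_complex V)"
proof -
  interpret field_subring V by fact
  show ?thesis
  proof (rule cringI)
    show "abelian_group (subring_of_complex V)"
    proof (rule abelian_groupI)
      fix x assume "x \<in> carrier (subring_of_complex V)"
      thus "\<exists>y\<in>carrier (subring_of_complex V). y \<oplus>\<^bsub>subring_of_complex V\<^esub> x = \<zero>\<^bsub>subring_of_complex V\<^esub>"
        by (intro bexI[of _ "- x"]) (auto simp: subring_of_complex_simps)
    qed (auto simp: subring_of_complex_simps)
    show "comm_monoid (subring_of_complex V)"
      by (rule comm_monoidI) (auto simp: subring_of_complex_simps)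
  qed (auto simp: subring_of_complex_simps algebra_simps)
qed

locale complex_char3_local_ring = char3_local_ring V M for V M :: "complex set"
begin

abbreviation "L \<equiv> subring_of_complex V"
abbreviation "k \<equiv> L Quot M"
abbreviation "\<phi> \<equiv> (\<lambda>x. M +>\<^bsub>L\<^esub> x)"

lemma cring_L: "cring L"
  by (rule cring_subring_of_complex[OF field_subring_axioms])

lemma ideal_M: "ideal M L"
proof (rule idealI)
  show "ring L" using cring_L by (rule cring.axioms)
  show "subgroup M (add_monoid L)"
  proof
    fix x assume x: "x \<in> M"
    interpret L: cring L by (rule cring_L)
    have "\<ominus>\<^bsub>L\<^esub> x = - x"
      using x M_subset by (intro L.minus_equality) (auto simp: subring_of_complex_simps)
    thus "inv\<^bsub>add_monoid L\<^esub> x \<in> M" using x by (simp add: a_inv_def)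
  qed (auto simp: subring_of_complex_simps M_subset M_add)
qed (auto simp: subring_of_complex_simps M_mult M_mult_right)

lemma coset_eq: "\<phi> x = {m + x | m. m \<in> M}"
  by (auto simp: a_r_coset_def' subring_of_complex_simps)

lemma coset_eq_iff: "\<phi> x = \<phi> y \<longleftrightarrow> x - y \<in> M"
proof
  assume "\<phi> x = \<phi> y"
  moreover have "0 + x \<in> \<phi> x" unfolding coset_eq by (intro CollectI exI[of _ 0]) auto
  ultimately obtain m where "0 + x = m + y" "m \<in> M" unfolding coset_eq by blast
  thus "x - y \<in> M" by simp
next
  have sub: "\<phi> x \<subseteq> \<phi> y" if "x - y \<in> M" for x y
  proof
    fix w assume "w \<in> \<phi> x"
    then obtain m where m: "w = m + x" "m \<in> M" unfolding coset_eq by blast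
    have "w = (m + (x - y)) + y" using m by simp
    thus "w \<in> \<phi> y" using M_add[OF m(2) that] unfolding coset_eq by blast
  qed
  assume xy: "x - y \<in> M"
  show "\<phi> x = \<phi> y" using sub[OF xy] sub[OF xy[unfolded M_diff_commute[of x y]]] by blast
qed

lemma maximalideal_M: "maximalideal M L"
proof (rule maximalidealI[OF ideal_M])
  show "carrier L \<noteq> M" using one_notin_M one_mem by (auto simp: subring_of_complex_simps)
  fix J assume J: "ideal J L" "M \<subseteq> J" "J \<subseteq> carrier L"
  interpret J: ideal J L by fact
  show "J = M \<or> J = carrier L"
  proof (cases "J \<subseteq> M")
    case False
    then obtain x where x: "x \<in> J" "x \<notin> M" by blast
    have xV: "x \<in> V" using x J by (auto simp: subring_of_complex_simps)
    have "inverse x \<otimes>\<^bsub>L\<^esub> x \<in> J"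
      using J.I_l_closed[OF x(1)] inverse_mem[OF xV x(2)] by (simp add: subring_of_complex_simps)
    moreover have "x \<noteq> 0" using x by auto
    ultimately have one: "1 \<in> J" by (simp add: subring_of_complex_simps)
    have "carrier L \<subseteq> J"
    proof
      fix y assume "y \<in> carrier L"
      from J.I_l_closed[OF one this] show "y \<in> J" by (simp add: subring_of_complex_simps)
    qed
    thus ?thesis using J by blast
  qed (use J in blast)
qed

lemma field_k: "field k"
  by (rule maximalideal.quotient_is_field[OF maximalideal_M cring_L])

lemma ring_hom_coset: "ring_hom_cring L k \<phi>"
  using ideal.rcos_ring_hom_cring[OF ideal_M cring_L] .

lemma carrier_k: "carrier k = \<phi> ` V"
  by (auto simp: FactRing_def A_RCOSETS_def' subring_of_complex_simps)

lemma bij_betw_T: "bij_betw \<phi> T (carrier k)"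
  unfolding bij_betw_def
proof
  show "inj_on \<phi> T" by (intro inj_onI) (simp add: coset_eq_iff T_eqI)
  show "\<phi> ` T = carrier k"
    unfolding carrier_k
  proof (intro equalityI subsetI)
    fix u assume "u \<in> \<phi> ` V"
    then obtain x where x: "x \<in> V" "u = \<phi> x" by blast
    hence "u = \<phi> (rep x)" using rep_props(2)[OF x(1)] by (simp add: coset_eq_iff M_diff_commute)
    thus "u \<in> \<phi> ` T" using rep_mem_T[OF x(1)] by blast
  qed (use T_subset in blast)
qed

text \<open>
  This is the passage from cosets to congruences: equations between cosets of elements of \<open>V\<close> are
  congruences between these elements, and the additional point is the one at infinity.
\<close>
lemma card_points:
  assumes a: "a1 \<in> V" "a2 \<in> V" "a3 \<in> V" "a4 \<in> V" "a6 \<in> V"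
  shows "card (points k (map_weierstrass \<phi> (Weierstrass a1 a2 a3 a4 a6))) =
    Suc (card {(x, y). x \<in> T \<and> y \<in> T \<and>
      (y\<^sup>2 + a1 * x * y + a3 * y) - (x ^ 3 + a2 * x\<^sup>2 + a4 * x + a6) \<in> M})"
    (is "_ = Suc (card ?S)")
proof -
  interpret h: ring_hom_cring L k \<phi> by (rule ring_hom_coset)
  let ?E = "\<lambda>u v. v [^]\<^bsub>k\<^esub> (2::nat) \<oplus>\<^bsub>k\<^esub> \<phi> a1 \<otimes>\<^bsub>k\<^esub> u \<otimes>\<^bsub>k\<^esub> v \<oplus>\<^bsub>k\<^esub> \<phi> a3 \<otimes>\<^bsub>k\<^esub> v =
       u [^]\<^bsub>k\<^esub> (3::nat) \<oplus>\<^bsub>k\<^esub> \<phi> a2 \<otimes>\<^bsub>k\<^esub> u [^]\<^bsub>k\<^esub> (2::nat) \<oplus>\<^bsub>k\<^esub> \<phi> a4 \<otimes>\<^bsub>k\<^esub> u \<oplus>\<^bsub>k\<^esub> \<phi> a6"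
  have add: "\<phi> x \<oplus>\<^bsub>k\<^esub> \<phi> y = \<phi> (x + y)" if "x \<in> V" "y \<in> V" for x y
    using h.hom_add[of x y] that by (simp add: subring_of_complex_simps)
  have mult: "\<phi> x \<otimes>\<^bsub>k\<^esub> \<phi> y = \<phi> (x * y)" if "x \<in> V" "y \<in> V" for x y
    using h.hom_mult[of x y] that by (simp add: subring_of_complex_simps)
  have pow: "\<phi> x [^]\<^bsub>k\<^esub> (n :: nat) = \<phi> (x ^ n)" if "x \<in> V" for x n
    using h.ring.hom_nat_pow[of x n] that by (simp add: subring_of_complex_simps subring_of_complex_pow)
  have E_iff: "?E (\<phi> x) (\<phi> y) \<longleftrightarrow> (y\<^sup>2 + a1 * x * y + a3 * y) - (x ^ 3 + a2 * x\<^sup>2 + a4 * x + a6) \<in> M"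
    if "x \<in> V" "y \<in> V" for x y
    using that a by (simp only: add mult pow coset_eq_iff add_mem mult_mem power_mem)
  have "bij_betw (\<lambda>(x, y). (\<phi> x, \<phi> y)) ?S {(u, v). u \<in> carrier k \<and> v \<in> carrier k \<and> ?E u v}"
    unfolding bij_betw_def
  proof
    have "inj_on \<phi> T" using bij_betw_T by (rule bij_betw_imp_inj_on)
    hence "inj_on (map_prod \<phi> \<phi>) (T \<times> T)" by (intro map_prod_inj_on)
    hence "inj_on (map_prod \<phi> \<phi>) ?S" by (rule inj_on_subset) auto
    thus "inj_on (\<lambda>(x, y). (\<phi> x, \<phi> y)) ?S" by (simp add: map_prod_def)
    show "(\<lambda>(x, y). (\<phi> x, \<phi> y)) ` ?S = {(u, v). u \<in> carrier k \<and> v \<in> carrier k \<and> ?E u v}"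
    proof (intro equalityI subsetI)
      fix p assume "p \<in> (\<lambda>(x, y). (\<phi> x, \<phi> y)) ` ?S"
      then obtain w where w: "p = (\<lambda>(x, y). (\<phi> x, \<phi> y)) w" "w \<in> ?S" by (elim imageE)
      obtain x y where "w = (x, y)" by (cases w)
      with w have p: "p = (\<phi> x, \<phi> y)" and S: "(x, y) \<in> ?S" by simp_all
      from S have xy: "x \<in> V" "y \<in> V" using T_subset by blast+
      have "?E (\<phi> x) (\<phi> y)" using S unfolding E_iff[OF xy] by blast
      moreover have "\<phi> x \<in> carrier k" "\<phi> y \<in> carrier k" using xy carrier_k by blast+
      ultimately show "p \<in> {(u, v). u \<in> carrier k \<and> v \<in> carrier k \<and> ?E u v}"
        unfolding p mem_Collect_eq prod.case by (intro conjI)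
    next
      fix p assume "p \<in> {(u, v). u \<in> carrier k \<and> v \<in> carrier k \<and> ?E u v}"
      then obtain u v where p: "p = (u, v)" and uv: "u \<in> carrier k" "v \<in> carrier k" and E: "?E u v" by blast
      from uv have "u \<in> \<phi> ` T" "v \<in> \<phi> ` T" using bij_betw_imp_surj_on[OF bij_betw_T] by simp_all
      then obtain x y where xy: "x \<in> T" "y \<in> T" and eq: "u = \<phi> x" "v = \<phi> y" by (elim imageE)
      have "(x, y) \<in> ?S"
        using E xy unfolding eq E_iff[OF T_subset[OF xy(1)] T_subset[OF xy(2)]] by blast
      moreover have "p = (\<lambda>(x, y). (\<phi> x, \<phi> y)) (x, y)" unfolding p eq by simp
      ultimately show "p \<in> (\<lambda>(x, y). (\<phi> x, \<phi> y)) ` ?S" by (rule rev_image_eqI)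
    qed
  qed
  hence card_eq: "card ?S = card {(u, v). u \<in> carrier k \<and> v \<in> carrier k \<and> ?E u v}"
    by (rule bij_betw_same_card)
  have "finite (carrier k)" using bij_betw_finite[OF bij_betw_T] finite_T by simp
  hence "finite {(u, v). u \<in> carrier k \<and> v \<in> carrier k \<and> ?E u v}"
    by (intro finite_subset[OF _ finite_cartesian_product[of "carrier k" "carrier k"]]) auto
  thus ?thesis unfolding weierstrass.map points.simps card_eq
    by (subst card_insert_disjoint) (auto simp: card_image)
qed

text \<open>
  Over a field with finitely many elements the dimension exists, since all the elements together
  span; and it is not 0 because \<open>1 \<noteq> 0\<close>.
\<close>
lemma residue_dim_pos: "ring.dim k (generate_field k {}) (carrier k) > 0"
proof -
  interpret k: field k by (rule field_k)
  let ?F = "generate_field k {}"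
  have F: "subfield ?F k" by (rule k.generate_field_is_subfield) simp
  have "finite (carrier k)" using bij_betw_finite[OF bij_betw_T] finite_T by simp
  then obtain us where us: "set us = carrier k" using finite_list by blast
  have "k.Span ?F us = carrier k"
    using k.Span_base_incl[OF F, of us] k.Span_in_carrier[of ?F us] us subfieldE(3)[OF F] by auto
  hence "k.finite_dimension ?F (carrier k)"
    using k.Span_finite_dimension[OF F, of us] us by simp
  hence dim: "k.dimension (k.dim ?F (carrier k)) ?F (carrier k)"
    using k.finite_dimensionE[OF F] by (simp add: over_def)
  show ?thesis
  proof (rule ccontr)
    assume "\<not> ?thesis"
    hence "k.dimension 0 ?F (carrier k)" using dim by simp
    hence "carrier k = {\<zero>\<^bsub>k\<^esub>}" by (rule k.dimension_zero[OF F])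
    thus False using k.one_closed k.one_not_zero by auto
  qed
qed

end


section \<open>Localization at a prime above 3\<close>

locale prime_above_3 =
  fixes r :: nat and z :: complex and P :: "complex set"
  assumes r_pos: "r > 0" and coprime_3_r: "coprime 3 r" and root_of_unity: "z ^ r = 1"
    and P: "P \<in> primes_above 3 (adjoin_rat z)"
begin

abbreviation "K \<equiv> adjoin_rat z"
abbreviation "OK \<equiv> integers_of K"
abbreviation "V \<equiv> carrier (local_ring K P)"
abbreviation "M \<equiv> local_maximal_ideal K P"

sublocale K: field_subring K
  by (rule field_subring_adjoin_rat)

lemma primeideal_P: "primeideal P (subring_of_complex OK)"
  using P by (simp add: primes_above_def)

lemma three_mem_P: "3 \<in> P"
  using P by (simp add: primes_above_def)

lemma OK_subset: "x \<in> OK \<Longrightarrow> x \<in> K"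
  by (simp add: integers_of_def)

text \<open>
  That the integers of \<open>K\<close> are closed under sums and products is part of the hypothesis that \<open>P\<close> is a
  prime ideal of a ring.
\<close>

sublocale OK: field_subring OK
proof -
  interpret primeideal P "subring_of_complex OK" by (rule primeideal_P)
  show "field_subring OK"
  proof
    show "1 \<in> OK" using one_closed by (simp add: subring_of_complex_simps)
    show "x + y \<in> OK" "x * y \<in> OK" if "x \<in> OK" "y \<in> OK" for x y
      using a_closed[of x y] m_closed[of x y] that by (simp_all add: subring_of_complex_simps)
    show "- x \<in> OK" if "x \<in> OK" for x using that by (auto simp: integers_of_def)
  qed
qed

lemma P_props:
  shows P_subset: "x \<in> P \<Longrightarrow> x \<in> OK"
    and P_add: "x \<in> P \<Longrightarrow> y \<in> P \<Longrightarrow> x + y \<in> P"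
    and P_mult: "x \<in> OK \<Longrightarrow> y \<in> P \<Longrightarrow> x * y \<in> P"
    and P_prime: "x \<in> OK \<Longrightarrow> y \<in> OK \<Longrightarrow> x * y \<in> P \<Longrightarrow> x \<in> P \<or> y \<in> P"
    and one_notin_P: "1 \<notin> P"
proof -
  interpret primeideal P "subring_of_complex OK" by (rule primeideal_P)
  show "x \<in> P \<Longrightarrow> x \<in> OK" using a_subset by (auto simp: subring_of_complex_simps)
  show "x \<in> P \<Longrightarrow> y \<in> P \<Longrightarrow> x + y \<in> P"     using additive_subgroup.a_closed[OF is_additive_subgroup, of x y] by (simp add: subring_of_complex_simps)
  show "x \<in> OK \<Longrightarrow> y \<in> P \<Longrightarrow> x * y \<in> P" using I_l_closed[of y x] by (simp add: subring_of_complex_simps)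
  show "x \<in> OK \<Longrightarrow> y \<in> OK \<Longrightarrow> x * y \<in> P \<Longrightarrow> x \<in> P \<or> y \<in> P"
    using I_prime[of x y] by (simp add: subring_of_complex_simps)
  show "1 \<notin> P" using one_imp_carrier I_notcarr by (auto simp: subring_of_complex_simps)
qed

lemma of_int_notin_P: assumes "\<not> 3 dvd m" shows "of_int m \<notin> P"
proof
  assume m: "of_int m \<in> P"
  have "coprime 3 m" using assms by (intro prime_imp_coprime) auto
  then obtain u v where "u * 3 + v * m = 1" using bezout_int[of 3 m] by auto
  hence "1 = (of_int (u * 3 + v * m) :: complex)" by simp
  also have "\<dots> = of_int u * 3 + of_int v * of_int m" by simp
  also have "\<dots> \<in> P" by (intro P_add P_mult three_mem_P m) auto
  finally show False using one_notin_P by simp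
qed

lemma z_mem_OK: "z \<in> OK"
proof -
  have "algebraic_int z"
    by (rule algebraic_int_root[of 1 "Polynomial.monom 1 r"])
       (use r_pos root_of_unity in \<open>auto simp: poly_monom degree_monom_eq coeff_monom\<close>)
  thus ?thesis using adjoin_rat_self by (simp add: integers_of_def)
qed

lemma int_adjoin_subset_OK: "x \<in> int_adjoin z \<Longrightarrow> x \<in> OK"
  by (rule int_adjoin_least[OF OK.field_subring_axioms z_mem_OK])

lemma V_iff: "x \<in> V \<longleftrightarrow> (\<exists>a s. x = a / s \<and> a \<in> OK \<and> s \<in> OK \<and> s \<notin> P)"
  by (auto simp: local_ring_def subring_of_complex_simps)

lemma M_iff: "x \<in> M \<longleftrightarrow> (\<exists>a s. x = a / s \<and> a \<in> P \<and> s \<in> OK \<and> s \<notin> P)"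
  by (auto simp: local_maximal_ideal_def)

lemma notin_P_nonzero: "s \<notin> P \<Longrightarrow> s \<noteq> 0"
  using P_mult[OF OK.zero_mem three_mem_P] by auto

lemma OK_subset_V: "x \<in> OK \<Longrightarrow> x \<in> V"
  unfolding V_iff by (intro exI[of _ x] exI[of _ 1]) (auto simp: one_notin_P)

sublocale V: field_subring V
proof
  show "1 \<in> V" by (rule OK_subset_V) simp
  show "- x \<in> V" if "x \<in> V" for x
  proof -
    from that obtain a s where "x = a / s" "a \<in> OK" "s \<in> OK" "s \<notin> P" unfolding V_iff by blast
    thus ?thesis unfolding V_iff by (intro exI[of _ "- a"] exI[of _ s]) auto
  qed
  fix x y assume "x \<in> V" "y \<in> V"
  then obtain a s b t where *: "x = a / s" "a \<in> OK" "s \<in> OK" "s \<notin> P" "y = b / t" "b \<in> OK" "t \<in> OK" "t \<notin> P"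
    unfolding V_iff by blast
  hence st: "s * t \<notin> P" "s \<noteq> 0" "t \<noteq> 0" using P_prime notin_P_nonzero by blast+
  show "x + y \<in> V" unfolding V_iff
    by (intro exI[of _ "a * t + b * s"] exI[of _ "s * t"]) (use * st in \<open>auto simp: field_simps\<close>)
  show "x * y \<in> V" unfolding V_iff
    by (intro exI[of _ "a * b"] exI[of _ "s * t"]) (use * st in auto)
qed

text \<open>An exponent \<open>q = 3\<^sup>f\<close> with \<open>q \<equiv> 1 (mod r)\<close>, so that \<open>z\<^sup>q = z\<close>.\<close>
definition q :: nat where
  "q = 3 ^ totient r"

lemma totient_r_pos: "totient r > 0"
  using r_pos by simp

lemma z_power_q: "z ^ q = z"
proof -
  have "[q = 1] (mod r)" unfolding q_def by (rule euler_theorem[OF coprime_3_r])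
  moreover have "1 \<le> q" by (simp add: q_def)
  ultimately have "r dvd q - 1" using cong_to_1_nat by blast
  then obtain n where "q - 1 = r * n" by auto
  hence "q = Suc (r * n)" using \<open>1 \<le> q\<close> by simp
  thus ?thesis by (simp add: power_mult root_of_unity)
qed

lemma q_ge_2: "q \<ge> 2"
proof -
  have "(3 :: nat) ^ 1 \<le> 3 ^ totient r"     using totient_r_pos by (intro power_increasing Suc_leI[of 0, folded One_nat_def]) auto
  thus ?thesis by (simp add: q_def)
qed

abbreviation "W \<equiv> int_adjoin_at_3 z"

lemma int_adjoin_subset_W: "x \<in> int_adjoin z \<Longrightarrow> x \<in> W"
  unfolding int_adjoin_at_3_def by (intro CollectI exI[of _ 1]) auto

sublocale int_adjoin_frobenius: frobenius_subring "int_adjoin z" q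
proof -
  interpret Z: field_subring "int_adjoin z" by (rule field_subring_int_adjoin)
  show "frobenius_subring (int_adjoin z) q"
  proof
    show "q \<ge> 2" by (rule q_ge_2)
    show "\<exists>y\<in>int_adjoin z. x ^ q = x + 3 * y" if "x \<in> int_adjoin z" for x
      using frobenius_int_adjoin[OF _ that] z_power_q unfolding q_def by blast
  qed
qed

sublocale W: frobenius_subring W q
proof (rule frobenius_subring_localization[OF int_adjoin_frobenius.frobenius_subring_axioms])
  show "field_subring W" by (rule field_subring_int_adjoin_at_3)
  show "x \<in> int_adjoin z \<Longrightarrow> x \<in> W" for x by (rule int_adjoin_subset_W)
  fix x assume "x \<in> W"
  then obtain m where m: "\<not> 3 dvd m" "of_int m * x \<in> int_adjoin z"
    by (auto simp: int_adjoin_at_3_def)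
  have "m \<noteq> 0" using m by auto
  moreover have "inverse (of_int m) \<in> W"
    using m(1) \<open>m \<noteq> 0\<close> unfolding int_adjoin_at_3_def by (intro CollectI exI[of _ m]) auto
  ultimately show "\<exists>s\<in>int_adjoin z. inverse s \<in> W \<and> s \<noteq> 0 \<and> s * x \<in> int_adjoin z"
    using m(2) by (intro bexI[of _ "of_int m"]) auto
qed

lemma K_three_power: "x \<in> K \<Longrightarrow> \<exists>j. 3 ^ j * x \<in> W"
  using three_power_mult_mem_at_3 adjoin_rat_subset_fractions[of z "r - 1"] root_of_unity r_pos by simp

text \<open>
  The part at 3 of the theorem that \<open>\<int>[\<zeta>\<^sub>r]\<close> is the ring of integers of \<open>\<rat>(\<zeta>\<^sub>r)\<close>.
\<close>
lemma OK_subset_W: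
  assumes "x \<in> OK"
  shows "x \<in> W"
proof -
  obtain j where j: "3 ^ j * x \<in> W" using K_three_power OK_subset assms by blast
  from assms obtain p where p: "lead_coeff p = 1" "\<forall>i. coeff p i \<in> \<int>" "poly p x = 0"
    by (auto simp: integers_of_def algebraic_int.simps)
  have "coeff p i \<in> W" for i using p(2) by (auto elim!: Ints_cases dest!: spec[of _ i])
  from W.integral_mem[OF p(1) this p(3) j] show ?thesis .
qed

lemma W_subset_V:
  assumes "x \<in> W"
  shows "x \<in> V"
proof -
  from assms obtain m where m: "\<not> 3 dvd m" "of_int m * x \<in> int_adjoin z"
    by (auto simp: int_adjoin_at_3_def)
  have "m \<noteq> 0" using m by auto
  thus ?thesis unfolding V_iff
    by (intro exI[of _ "of_int m * x"] exI[of _ "of_int m"])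
       (use m of_int_notin_P int_adjoin_subset_OK in auto)
qed

sublocale V_frobenius: frobenius_subring V q
proof (rule frobenius_subring_localization[OF W.frobenius_subring_axioms V.field_subring_axioms])
  show "x \<in> W \<Longrightarrow> x \<in> V" for x by (rule W_subset_V)
  fix x assume "x \<in> V"
  then obtain a s where *: "x = a / s" "a \<in> OK" "s \<in> OK" "s \<notin> P" unfolding V_iff by blast
  moreover have "inverse s \<in> V"
    unfolding V_iff by (intro exI[of _ 1] exI[of _ s]) (use * in \<open>auto simp: field_simps\<close>)
  ultimately show "\<exists>s\<in>W. inverse s \<in> V \<and> s \<noteq> 0 \<and> s * x \<in> W"
    using OK_subset_W notin_P_nonzero by (intro bexI[of _ s]) auto
qed

lemma V_integrally_closed:
  assumes "x \<in> K" "lead_coeff p = 1" "\<And>i. coeff p i \<in> V" "poly p x = 0"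
  shows "x \<in> V"
proof -
  obtain j where "3 ^ j * x \<in> W" using K_three_power assms(1) by blast
  from V_frobenius.integral_mem[OF assms(2-4) W_subset_V[OF this]] show ?thesis .
qed

text \<open>
  The residue field is generated by \<open>z\<close>, hence finite. A denominator \<open>s\<close> satisfies
  \<open>s\<^sup>q \<equiv> s (mod 3)\<close>, so modulo 3 its inverse is \<open>s\<^sup>q\<^sup>-\<^sup>2\<close>; and a rational denominator prime to 3 is its own
  inverse modulo 3.
\<close>
lemma cong_int_adjoin:
  assumes "x \<in> V"
  shows "\<exists>y\<in>int_adjoin z. \<exists>v\<in>V. x - y = 3 * v"
proof -
  from assms obtain a s where *: "x = a / s" "a \<in> OK" "s \<in> OK" "s \<notin> P" unfolding V_iff by blast
  have s0: "s \<noteq> 0" using * notin_P_nonzero by blast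
  have inv: "inverse s \<in> V"
    unfolding V_iff by (intro exI[of _ 1] exI[of _ s]) (use * in \<open>auto simp: field_simps\<close>)
  obtain w where w: "w \<in> V" "s ^ q = s + 3 * w"
    using V_frobenius.frobenius[OF OK_subset_V[OF *(3)]] by blast
  have "s ^ q = s ^ (2 + (q - 2))"
    by (rule arg_cong[OF le_add_diff_inverse[OF q_ge_2, symmetric]])
  also have "\<dots> = s * s * s ^ (q - 2)" by (simp only: power_add power2_eq_square)
  finally have "s ^ q = s * s * s ^ (q - 2)" .
  hence "s * s ^ (q - 2) = 1 + 3 * (w * inverse s)"
    using w(2) s0 by (simp add: field_simps)
  moreover have "a * s ^ (q - 2) = x * (s * s ^ (q - 2))" using s0 *(1) by simp
  ultimately have "x - a * s ^ (q - 2) = 3 * (- (x * (w * inverse s)))"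
    by (simp add: algebra_simps)
  moreover have "- (x * (w * inverse s)) \<in> V" using assms w inv by (intro V.uminus_mem V.mult_mem)
  ultimately obtain v where v: "v \<in> V" "x - a * s ^ (q - 2) = 3 * v" by blast
  define b where "b = a * s ^ (q - 2)"
  have b: "b \<in> W" using * OK_subset_W by (auto simp: b_def)
  then obtain m where m: "\<not> 3 dvd m" "of_int m * b \<in> int_adjoin z"
    by (auto simp: int_adjoin_at_3_def)
  have "3 dvd (m - 1) * (m + 1)"
    using m(1) unfolding three_dvd_int_mult_iff by presburger
  hence "3 dvd m * m - 1" by (simp add: algebra_simps)
  then obtain n where n: "m * m - 1 = 3 * n" by auto
  have "x - of_int m * (of_int m * b) = 3 * v - of_int (m * m - 1) * b"
    using v(2) by (simp add: b_def algebra_simps)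
  also have "\<dots> = 3 * (v - of_int n * b)" unfolding n by (simp add: algebra_simps)
  finally have "x - of_int m * (of_int m * b) = 3 * (v - of_int n * b)" .
  moreover have "v - of_int n * b \<in> V" using v b W_subset_V by auto
  ultimately show ?thesis using int_adjoin_int_mult[OF m(2)] by blast
qed

sublocale complex_char3_local_ring V M
proof
  show "x \<in> V" if "x \<in> M" for x using that P_subset unfolding V_iff M_iff by blast
  show "x + y \<in> M" if "x \<in> M" "y \<in> M" for x y
  proof -
    from that obtain a s b t where *: "x = a / s" "a \<in> P" "s \<in> OK" "s \<notin> P" "y = b / t" "b \<in> P" "t \<in> OK" "t \<notin> P"
      unfolding M_iff by blast
    hence st: "s * t \<notin> P" "s \<noteq> 0" "t \<noteq> 0" using P_prime notin_P_nonzero by blast+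
    have "x + y = (t * a + s * b) / (s * t)"
      using * st by (simp add: add_frac_eq mult.commute)
    moreover have "t * a + s * b \<in> P" using * by (intro P_add P_mult)
    moreover have "s * t \<in> OK" using * by auto
    ultimately show "x + y \<in> M" unfolding M_iff using st by blast
  qed
  show mult: "x * y \<in> M" if "x \<in> V" "y \<in> M" for x y
  proof -
    from that obtain a s b t where *: "x = a / s" "a \<in> OK" "s \<in> OK" "s \<notin> P" "y = b / t" "b \<in> P" "t \<in> OK" "t \<notin> P"
      unfolding M_iff V_iff by blast
    hence st: "s * t \<notin> P" using P_prime by blast
    show "x * y \<in> M" unfolding M_iff
      by (intro exI[of _ "a * b"] exI[of _ "s * t"]) (use * st in \<open>auto intro: P_mult\<close>)
  qed
  show "1 \<notin> M"
  proof
    assume "1 \<in> M"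
    then obtain a s where *: "1 = a / s" "a \<in> P" "s \<notin> P" unfolding M_iff by blast
    hence "a = s" using notin_P_nonzero[of s] by (simp add: field_simps)
    thus False using * by simp
  qed
  show "inverse x \<in> V" if "x \<in> V" "x \<notin> M" for x
  proof -
    from that obtain a s where *: "x = a / s" "a \<in> OK" "s \<in> OK" "s \<notin> P" unfolding V_iff by blast
    hence "a \<notin> P" using that(2) unfolding M_iff by blast
    thus ?thesis unfolding V_iff by (intro exI[of _ s] exI[of _ a]) (use * in auto)
  qed
  show three: "3 \<in> M"
    unfolding M_iff by (intro exI[of _ 3] exI[of _ 1]) (auto simp: three_mem_P one_notin_P)
  define F where "F = (\<lambda>c :: nat \<Rightarrow> int. \<Sum>i<r. of_int (c i) * z ^ i) ` ({..<r} \<rightarrow>\<^sub>E {0..2})"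
  show "\<exists>F. finite F \<and> (\<forall>x\<in>V. \<exists>y\<in>F. x - y \<in> M)"
  proof (intro exI[of _ F] conjI ballI)
    show "finite F" unfolding F_def by (intro finite_imageI finite_PiE) auto
    fix x assume "x \<in> V"
    then obtain y v where y: "y \<in> int_adjoin z" and v: "v \<in> V" "x - y = 3 * v"
      using cong_int_adjoin by blast
    obtain c :: "nat \<Rightarrow> int" where c: "y = (\<Sum>i<r. of_int (c i) * z ^ i)"
      using int_adjoin_root_of_unity[OF _ y, of "r - 1"] root_of_unity r_pos by auto
    define y' where "y' = (\<Sum>i<r. of_int (c i mod 3) * z ^ i)"
    have "of_int (c i) = of_int (c i mod 3) + (3 * of_int (c i div 3) :: complex)" for i
      using arg_cong[OF mod_mult_div_eq[of "c i" 3, symmetric], of "of_int :: int \<Rightarrow> complex"]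
      by (simp only: of_int_add of_int_mult of_int_numeral)
    hence "y = (\<Sum>i<r. of_int (c i mod 3) * z ^ i + 3 * (of_int (c i div 3) * z ^ i))"
      unfolding c by (intro sum.cong refl) (simp add: algebra_simps)
    also have "\<dots> = y' + 3 * (\<Sum>i<r. of_int (c i div 3) * z ^ i)"
      by (simp add: y'_def sum.distrib sum_distrib_left)
    finally have "x - y' = (v + (\<Sum>i<r. of_int (c i div 3) * z ^ i)) * 3"
      using v(2) by (simp add: algebra_simps)
    also have "\<dots> \<in> M"
      using v(1) OK_subset_V[OF z_mem_OK] by (intro mult three V.add_mem V.sum_mem V.mult_mem) auto
    finally have "x - y' \<in> M" .
    moreover have "c i mod 3 \<in> {0..2}" for i by simp
    hence "y' \<in> F"
      unfolding F_def y'_def by (intro image_eqI[of _ _ "\<lambda>i\<in>{..<r}. c i mod 3"]) auto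
    ultimately show "\<exists>y\<in>F. x - y \<in> M" by blast
  qed
qed

lemma local_ring_eq: "local_ring K P = subring_of_complex V"
  by (simp add: local_ring_def subring_of_complex_simps)

lemma residue_field_eq: "residue_field K P = k"
  unfolding residue_field_def by (subst local_ring_eq) (rule refl)

lemma residue_degree_pos: "residue_degree K P > 0"
  unfolding residue_degree_def residue_field_eq Let_def by (rule residue_dim_pos)

lemma Units_local_ring: "x \<in> Units (local_ring K P) \<longleftrightarrow> x \<in> V \<and> x \<notin> M"
  unfolding arg_cong[OF local_ring_eq, of Units]
proof
  assume "x \<in> Units L"
  then obtain y where "x \<in> V" "y \<in> V" "y * x = 1"
    unfolding Units_def by (auto simp: subring_of_complex_simps)
  thus "x \<in> V \<and> x \<notin> M" using M_mult[of y x] one_notin_M by auto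
next
  assume x: "x \<in> V \<and> x \<notin> M"
  hence "x \<noteq> 0" "inverse x \<in> V" using inverse_mem by auto
  thus "x \<in> Units L"
    using x unfolding Units_def by (auto simp: subring_of_complex_simps intro!: bexI[of _ "inverse x"])
qed

end

section \<open>Good ordinary reduction of curves with rational 2-torsion\<close>

lemma adjoin_rat_divide: "x \<in> adjoin_rat z \<Longrightarrow> y \<in> adjoin_rat z \<Longrightarrow> x / y \<in> adjoin_rat z"
  using field_subring.mult_mem[OF field_subring_adjoin_rat _ adjoin_rat_inverse] by (simp add: divide_inverse)

lemma discriminant_of_roots:
  assumes b2: "a1\<^sup>2 + 4 * a2 = - 4 * (e1 + e2 + e3)"
    and b4: "2 * a4 + a1 * a3 = 2 * (e1 * e2 + e1 * e3 + e2 * e3)"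
    and b6: "a3\<^sup>2 + 4 * a6 = - 4 * (e1 * e2 * e3)"
  shows "discriminant (Weierstrass a1 a2 a3 a4 a6) = 16 * ((e1 - e2) * (e1 - e3) * (e2 - e3))\<^sup>2"
proof -
  define b2' b4' b6' where "b2' = a1\<^sup>2 + 4 * a2" "b4' = 2 * a4 + a1 * a3" "b6' = a3\<^sup>2 + 4 * a6"
  note defs = this
  have b8: "4 * (a1\<^sup>2 * a6 + 4 * a2 * a6 - a1 * a3 * a4 + a2 * a3\<^sup>2 - a4\<^sup>2) = b2' * b6' - b4'\<^sup>2"
    unfolding defs by (simp add: algebra_simps power2_eq_square)
  have "4 * discriminant (Weierstrass a1 a2 a3 a4 a6) =
      - (b2'\<^sup>2 * (4 * (a1\<^sup>2 * a6 + 4 * a2 * a6 - a1 * a3 * a4 + a2 * a3\<^sup>2 - a4\<^sup>2)))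
      - 32 * b4' ^ 3 - 108 * b6'\<^sup>2 + 36 * b2' * b4' * b6'"
    unfolding discriminant.simps Let_def defs by (simp add: algebra_simps)
  also have "\<dots> = - (b2'\<^sup>2 * (b2' * b6' - b4'\<^sup>2)) - 32 * b4' ^ 3 - 108 * b6'\<^sup>2 + 36 * b2' * b4' * b6'"
    unfolding b8 ..
  also have "\<dots> = 4 * (16 * ((e1 - e2) * (e1 - e3) * (e2 - e3))\<^sup>2)"
    unfolding defs b2 b4 b6 by (simp add: algebra_simps power2_eq_square power3_eq_cube)
  finally show ?thesis by simp
qed

lemma change_coords_scale:
  assumes "c \<noteq> 0"
  shows "change_coords c 0 0 0 (Weierstrass 0 (c\<^sup>2 * (B - A)) 0 (- (c\<^sup>2 * A * (c\<^sup>2 * B))) 0)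
    = Weierstrass 0 (B - A) 0 (- (A * B)) 0"
  using assms by (simp add: field_simps eval_nat_numeral)

lemma discriminant_two_torsion:
  "discriminant (Weierstrass 0 (B - A) 0 (- (A * B)) 0) = 16 * (A * B * (A + B))\<^sup>2"
  by (subst discriminant_of_roots[of 0 "B - A" 0 A "- B" "- (A * B)" 0 0])
     (auto simp: algebra_simps power2_eq_square)

context prime_above_3
begin

lemma V_subset_K: "x \<in> V \<Longrightarrow> x \<in> K"
  unfolding V_iff using OK_subset by (auto intro: adjoin_rat_divide)

lemma four_notin_M: "(4 :: complex) \<notin> M"
  using of_int_mem_M_iff[of 4] by simp

lemma discriminant_unit:
  assumes "A \<in> V" "B \<in> V" "A \<notin> M" "B \<notin> M" "A + B \<notin> M"
  shows "discriminant (Weierstrass 0 (B - A) 0 (- (A * B)) 0) \<in> Units (local_ring K P)"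
proof -
  have "(16 :: complex) \<notin> M" using of_int_mem_M_iff[of 16] by simp
  thus ?thesis
    unfolding discriminant_two_torsion Units_local_ring
    using assms by (auto simp: M_mult_iff M_power_iff)
qed

text \<open>
  The points of order 2 of any integral model have integral \<open>X\<close>-coordinates, because the
  local ring is integrally closed. Their differences are units, by the discriminant, and they are
  the differences of the original roots divided by \<open>u\<^sup>2\<close>. So \<open>v = 9\<^sup>n / u\<^sup>2\<close> is a unit, and the
  Hasse invariant of the model is \<open>v (B - A)\<close> modulo 3.
\<close>
lemma good_model_count:
  assumes AB: "A \<in> V" "B \<in> V" "A \<notin> M" "B - A \<notin> M"
    and model: "good_model K P (Weierstrass 0 (9 ^ n * (B - A)) 0 (- (9 ^ n * A * (9 ^ n * B))) 0) E'"
  shows "\<not> 3 dvd card (points k (map_weierstrass \<phi> E')) - 1"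
proof -
  define A' B' where "A' = 9 ^ n * A" "B' = 9 ^ n * B"
  note defs = this
  obtain a1 a2 a3 a4 a6 where E': "E' = Weierstrass a1 a2 a3 a4 a6" by (cases E')
  have "9 ^ n * (B - A) = B' - A'" by (simp add: defs right_diff_distrib)
  with model have iso: "isomorphic_over K (Weierstrass 0 (B' - A') 0 (- (A' * B')) 0) E'"
    and a: "set_weierstrass E' \<subseteq> V" and unit: "discriminant E' \<notin> M"
    unfolding good_model_def Units_local_ring defs by simp_all
  from iso obtain u \<rho> s t where K: "u \<in> K" "u \<noteq> 0" "\<rho> \<in> K"
    and change: "E' = change_coords u \<rho> s t (Weierstrass 0 (B' - A') 0 (- (A' * B')) 0)"
    unfolding isomorphic_over_def by blast
  from a have aV: "a1 \<in> V" "a2 \<in> V" "a3 \<in> V" "a4 \<in> V" "a6 \<in> V" by (auto simp: E')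
  have coeffs: "a1 = 2 * s / u" "a2 = (B' - A' + 3 * \<rho> - s\<^sup>2) / u\<^sup>2" "a3 = 2 * t / u ^ 3"
    "a4 = (- (A' * B') + 2 * \<rho> * (B' - A') + 3 * \<rho>\<^sup>2 - 2 * s * t) / u ^ 4"
    "a6 = (\<rho> * - (A' * B') + \<rho>\<^sup>2 * (B' - A') + \<rho> ^ 3 - t\<^sup>2) / u ^ 6"
    using change by (simp_all add: E')
  define e1 e2 e3 where "e1 = - \<rho> / u\<^sup>2" "e2 = (A' - \<rho>) / u\<^sup>2" "e3 = (- B' - \<rho>) / u\<^sup>2"
  note e = this
  have pow: "u ^ 4 = u\<^sup>2 * u\<^sup>2" "u ^ 6 = u\<^sup>2 * u\<^sup>2 * u\<^sup>2" "u ^ 3 = u\<^sup>2 * u"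
    by (simp_all add: eval_nat_numeral)
  have b2: "a1\<^sup>2 + 4 * a2 = - 4 * (e1 + e2 + e3)"
    using K(2) unfolding coeffs e by (simp add: power_divide add_divide_distrib[symmetric] diff_divide_distrib[symmetric] power_mult_distrib)
  have b4: "2 * a4 + a1 * a3 = 2 * (e1 * e2 + e1 * e3 + e2 * e3)"
    using K(2) unfolding coeffs e by (simp add: field_simps eval_nat_numeral)
  have b6: "a3\<^sup>2 + 4 * a6 = - 4 * (e1 * e2 * e3)"
    using K(2) unfolding coeffs e by (simp add: field_simps eval_nat_numeral)
  have "A' \<in> K" "B' \<in> K" using AB V_subset_K by (auto simp: defs)
  hence eK: "e1 \<in> K" "e2 \<in> K" "e3 \<in> K"
    using K by (auto simp: e intro!: adjoin_rat_divide)
  define p where "p = [:- (e1 * e2 * e3), e1 * e2 + e1 * e3 + e2 * e3, - (e1 + e2 + e3), 1:]"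
  have "- (e1 + e2 + e3) = (a1\<^sup>2 + 4 * a2) / 4" "e1 * e2 + e1 * e3 + e2 * e3 = (2 * a4 + a1 * a3) / 2"
    "- (e1 * e2 * e3) = (a3\<^sup>2 + 4 * a6) / 4"
    unfolding b2 b4 b6 by simp_all
  moreover have "(a1\<^sup>2 + 4 * a2) / 4 \<in> V" "(2 * a4 + a1 * a3) / 2 \<in> V" "(a3\<^sup>2 + 4 * a6) / 4 \<in> V"
    using aV four_notin_M two_notin_M by (auto intro!: divide_mem)
  ultimately have coeffs_V: "- (e1 + e2 + e3) \<in> V" "e1 * e2 + e1 * e3 + e2 * e3 \<in> V" "- (e1 * e2 * e3) \<in> V"
    by (simp_all only:)
  have "Polynomial.coeff p i \<in> V" for i
    using coeffs_V unfolding p_def by (auto simp: coeff_pCons split: nat.splits simp del: minus_add_distrib)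
  moreover have "lead_coeff p = 1" by (simp add: p_def)
  moreover have "poly p e1 = 0" "poly p e2 = 0" "poly p e3 = 0"
    by (simp_all add: p_def algebra_simps)
  ultimately have eV: "e1 \<in> V" "e2 \<in> V" "e3 \<in> V"
    using V_integrally_closed eK by blast+
  have "16 * ((e1 - e2) * (e1 - e3) * (e2 - e3))\<^sup>2 \<notin> M"
    using unit unfolding E' discriminant_of_roots[OF b2 b4 b6] .
  hence distinct: "e1 - e2 \<notin> M" "e1 - e3 \<notin> M" "e2 - e3 \<notin> M"
    using eV by (auto simp: M_mult_iff M_power_iff)
  define v where "v = 9 ^ n / u\<^sup>2"
  have A0: "A \<noteq> 0" using AB by auto
  have vA: "v * A = e2 - e1" "v * (A - B) = e1 + e2 + e3 - 3 * e1"
    unfolding v_def e defs by (simp_all add: algebra_simps add_divide_distrib diff_divide_distrib)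
  hence "v = (e2 - e1) / A" using A0 by (simp add: field_simps)
  hence vV: "v \<in> V" using eV AB by (auto intro!: divide_mem)
  have vM: "v \<notin> M"
  proof
    assume "v \<in> M"
    from M_mult_right[OF this AB(1)] show False using distinct(1) M_diff_commute vA by metis
  qed
  have hasse: "e1 + e2 + e3 \<notin> M"
  proof
    assume "e1 + e2 + e3 \<in> M"
    hence "v * (A - B) \<in> M" unfolding vA by (rule M_diff[OF _ M_three_mult[OF eV(1)]])
    hence "A - B \<in> M" using M_prime[OF vV, of "A - B"] vM AB by auto
    thus False using AB(4) M_diff_commute by blast
  qed
  show ?thesis
    using affine_points_not_dvd[OF aV eV b2 b4 b6 distinct hasse] card_points[OF aV] by (simp add: E')
qed

theorem good_ordinary_reductionI:
  assumes AB: "A \<in> V" "B \<in> V" "A \<notin> M" "B \<notin> M" "A + B \<notin> M" "B - A \<notin> M"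
  shows "good_ordinary_reduction 3 K P (Weierstrass 0 (9 ^ n * (B - A)) 0 (- (9 ^ n * A * (9 ^ n * B))) 0)"
    (is "good_ordinary_reduction 3 K P ?E")
proof -
  let ?G = "Weierstrass 0 (B - A) 0 (- (A * B)) 0"
  have "(9 :: complex) ^ n = (3 * 3) ^ n" by simp
  hence nine: "(9 :: complex) ^ n = (3 ^ n)\<^sup>2" by (simp only: power_mult_distrib power2_eq_square)
  have "change_coords (3 ^ n) 0 0 0 ?E = ?G"
    unfolding nine by (rule change_coords_scale) simp
  hence "isomorphic_over K ?E ?G"
    unfolding isomorphic_over_def by (intro bexI[of _ "3 ^ n"] bexI[of _ 0]) auto
  moreover have "set_weierstrass ?G \<subseteq> V" using AB by auto
  ultimately have model: "good_model K P ?E ?G"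
    using discriminant_unit AB by (simp add: good_model_def)
  define E' where "E' = (SOME E'. good_model K P ?E E')"
  have E': "good_model K P ?E E'" unfolding E'_def by (rule someI[of "good_model K P ?E", OF model])
  have "reduction K P ?E = map_weierstrass \<phi> E'"
    unfolding reduction_def E'_def arg_cong[OF local_ring_eq, of "\<lambda>R x. M +>\<^bsub>R\<^esub> x", symmetric] ..
  hence trace: "trace_of_frobenius 3 K P ?E = 3 ^ residue_degree K P + 1 - int (card (points k (map_weierstrass \<phi> E')))"
    by (simp add: trace_of_frobenius_def residue_field_eq)
  have nd: "\<not> 3 dvd card (points k (map_weierstrass \<phi> E')) - 1"
    using good_model_count[OF AB(1-3,6) E'] .
  have "(3 :: int) dvd 3 ^ residue_degree K P" using residue_degree_pos by simp
  then obtain x :: int where x: "3 ^ residue_degree K P = 3 * x" by blast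
  have "\<not> 3 dvd 3 * x + 1 - int N" if "\<not> 3 dvd N - 1" for N :: nat
    using that by presburger
  hence "\<not> 3 dvd trace_of_frobenius 3 K P ?E"
    unfolding trace x using nd by blast
  thus ?thesis using model by (auto simp: good_ordinary_reduction_def good_reduction_def)
qed

end

section \<open>Cyclotomic units at a prime above 3\<close>

definition root_sum :: "complex \<Rightarrow> nat \<Rightarrow> complex" where
  "root_sum z j = z ^ j + inverse (z ^ j)"

lemma zeta_sum_eq_root_sum: "zeta_sum z (int j) = root_sum z j"
  by (simp add: zeta_sum_def root_sum_def power_int_minus)

lemma power_mult_root_sum: "z \<noteq> 0 \<Longrightarrow> z ^ j * root_sum z j = z ^ (2 * j) + 1"
  unfolding root_sum_def power_even_eq by (simp add: algebra_simps power2_eq_square)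

lemma root_sum_diff:
  assumes "z \<noteq> 0"
  shows "z ^ (j + n) * (root_sum z (j + n) - root_sum z j) = (z ^ (2 * j + n) - 1) * (z ^ n - 1)"
proof -
  have "(p * m) * ((p * m + inverse (p * m)) - (p + inverse p)) = (p\<^sup>2 * m - 1) * (m - 1)"
    if "p \<noteq> 0" "m \<noteq> 0" for p m :: complex
  proof -
    have "(p * m) * inverse (p * m) = 1" "p * m * inverse p = m"
      using that right_inverse[of "p * m"] by (simp_all del: inverse_mult_distrib)
    thus ?thesis by (simp only: ring_distribs power2_eq_square) (simp add: algebra_simps)
  qed
  from this[of "z ^ j" "z ^ n"] show ?thesis
    using assms unfolding root_sum_def power_add power_even_eq by simp
qed

locale cyclotomic_prime_above_3 = prime_above_3 +
  assumes prime_r: "prime r" and r_gt_7: "r > 7" and primitive: "primitive_root_of_unity r z"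
begin

lemma z_power_neq_1: "0 < m \<Longrightarrow> m < r \<Longrightarrow> z ^ m \<noteq> 1"
  using primitive by (simp add: primitive_root_of_unity_def)

lemma z_nonzero [simp]: "z \<noteq> 0"
  using root_of_unity r_pos by (auto simp: power_0_left)

lemma z_V [simp, intro]: "z \<in> V"
  by (rule OK_subset_V[OF z_mem_OK])

lemma z_power_notin_M: "z ^ j \<notin> M"
proof
  assume "z ^ j \<in> M"
  hence "(z ^ j) ^ r \<in> M" using r_pos by (simp add: M_power_iff)
  also have "(z ^ j) ^ r = 1" by (metis mult.commute power_mult power_one root_of_unity)
  finally show False using one_notin_M by simp
qed

lemma inverse_z_power_V: "inverse (z ^ j) \<in> V"
  by (rule inverse_mem) (auto simp: z_power_notin_M)

lemma z_power_mod: "z ^ (n mod r) = z ^ n"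
proof -
  have "z ^ n = z ^ (r * (n div r) + n mod r)" by simp
  also have "\<dots> = z ^ (n mod r)" by (simp only: power_add power_mult root_of_unity) simp
  finally show ?thesis ..
qed

text \<open>
  If \<open>z\<^sup>j \<equiv> 1\<close> with \<open>j\<close> prime to \<open>r\<close>, then \<open>z \<equiv> 1\<close>, and the relation \<open>1 + z + \<dots> + z\<^sup>r\<^sup>-\<^sup>1 = 0\<close>
  becomes \<open>r \<equiv> 0\<close>, which contradicts \<open>3 \<equiv> 0\<close>.
\<close>
lemma z_power_minus_1_notin_M:
  assumes "\<not> r dvd j"
  shows "z ^ j - 1 \<notin> M"
proof
  assume j: "z ^ j - 1 \<in> M"
  have power: "x ^ n - 1 \<in> M" if x: "x \<in> V" "x - 1 \<in> M" for x n
  proof (induction n)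
    case (Suc n)
    have "x ^ Suc n - 1 = x * (x ^ n - 1) + (x - 1)" by (simp add: algebra_simps)
    also have "\<dots> \<in> M" by (rule M_add[OF M_mult[OF x(1) Suc.IH] x(2)])
    finally show ?case .
  qed simp
  have "coprime j r" using prime_imp_coprime[OF prime_r assms] by (simp add: coprime_commute)
  then obtain u where u: "[j * u = 1] (mod r)" using cong_solve_coprime_nat by (auto simp: One_nat_def)
  have "(z ^ j) ^ u = z ^ ((j * u) mod r)" by (simp add: z_power_mod power_mult)
  also have "\<dots> = z" using u r_gt_7 by (simp add: cong_def)
  finally have z1: "z - 1 \<in> M" using power[OF _ j, of u] by auto
  have "(z - 1) * (\<Sum>i<r. z ^ i) = 0"
    using power_diff_1_eq[of z r] root_of_unity by simp
  moreover have "z - 1 \<noteq> 0" using z_power_neq_1[of 1] r_gt_7 by simp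
  ultimately have "(\<Sum>i<r. z ^ i) = 0" by simp
  hence "of_int (int r) = - (\<Sum>i<r. z ^ i - 1)" by (simp add: sum_subtractf)
  moreover have "(\<Sum>i\<in>I. z ^ i - 1) \<in> M" for I :: "nat set"
    by (induction I rule: infinite_finite_induct) (auto intro: M_add power[OF _ z1])
  hence "- (\<Sum>i<r. z ^ i - 1) \<in> M" by simp
  ultimately have "3 dvd int r" by (simp only: of_int_mem_M_iff[symmetric])
  moreover have "\<not> 3 dvd int r"
  proof
    assume "3 dvd int r"
    hence "3 dvd r" by presburger
    thus False using coprime_3_r by (auto dest: coprime_common_divisor_nat[of 3 r 3])
  qed
  ultimately show False by blast
qed

lemma odd_r: "odd r"
  using prime_odd_nat[OF prime_r] r_gt_7 by simp

text \<open>
  Otherwise \<open>z\<^sup>2\<^sup>j \<equiv> 1\<close>, so \<open>r\<close> divides \<open>j\<close> because it is odd, and then \<open>z\<^sup>j + 1 = 2\<close>.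
\<close>
lemma z_power_plus_1_notin_M: "z ^ j + 1 \<notin> M"
proof
  assume j: "z ^ j + 1 \<in> M"
  have "z ^ (2 * j) - 1 = (z ^ j - 1) * (z ^ j + 1)"
    unfolding power_even_eq by (simp add: algebra_simps power2_eq_square)
  also have "\<dots> \<in> M" by (rule M_mult[OF _ j]) auto
  finally have "r dvd 2 * j" using z_power_minus_1_notin_M by blast
  moreover have "coprime r 2" using odd_r by simp
  ultimately have "r dvd j" by (simp add: coprime_dvd_mult_right_iff)
  hence "z ^ j = 1" by (metis dvd_def power_mult power_one root_of_unity)
  thus False using j two_notin_M by simp
qed

abbreviation "t \<equiv> root_sum z"

lemma t_V [simp, intro]: "t j \<in> V"
  unfolding root_sum_def using inverse_z_power_V by auto

lemmas z_power_t = power_mult_root_sum[OF z_nonzero]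
lemmas t_diff = root_sum_diff[OF z_nonzero]

lemma t_diff_notin_M: "\<not> r dvd n \<Longrightarrow> \<not> r dvd 2 * j + n \<Longrightarrow> t (j + n) - t j \<notin> M"
  using t_diff[of j n] M_mult[of "z ^ (j + n)" "t (j + n) - t j"] z_power_minus_1_notin_M
  by (auto simp: M_mult_iff)

lemma t_minus_2_notin_M: assumes "\<not> r dvd j" shows "t j - 2 \<notin> M"
proof
  assume "t j - 2 \<in> M"
  hence "z ^ j * (t j - 2) \<in> M" by (intro M_mult) auto
  also have "z ^ j * (t j - 2) = (z ^ j - 1)\<^sup>2"
    unfolding right_diff_distrib z_power_t power_even_eq by (simp add: algebra_simps power2_eq_square)
  finally show False using z_power_minus_1_notin_M[OF assms] by (simp add: M_power_iff)
qed

lemma t_plus_2_notin_M: "t j + 2 \<notin> M"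
proof
  assume "t j + 2 \<in> M"
  hence "z ^ j * (t j + 2) \<in> M" by (intro M_mult) auto
  also have "z ^ j * (t j + 2) = (z ^ j + 1)\<^sup>2"
    unfolding distrib_left z_power_t power_even_eq by (simp add: algebra_simps power2_eq_square)
  finally show False using z_power_plus_1_notin_M[of j] by (simp add: M_power_iff)
qed

lemma t_mult: "t (j + n) * t j = t (2 * j + n) + t n"
proof -
  have "(p * m + inverse (p * m)) * (p + inverse p) = (p\<^sup>2 * m + inverse (p\<^sup>2 * m)) + (m + inverse m)"
    if "p \<noteq> 0" "m \<noteq> 0" for p m :: complex
  proof -
    have "p * m * inverse p = m" "inverse (p * m) * p = inverse m"
      "inverse (p * m) * inverse p = inverse (p\<^sup>2 * m)"
      using that by (simp_all add: power2_eq_square)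
    thus ?thesis by (simp only: ring_distribs) (simp add: algebra_simps power2_eq_square)
  qed
  from this[of "z ^ j" "z ^ n"] show ?thesis
    unfolding root_sum_def power_add power_even_eq by simp
qed

lemma t_0: "t 0 = 2"
  by (simp add: root_sum_def)

lemma t_notin_M: "t j \<notin> M"
proof
  assume "t j \<in> M"
  hence "t j * t j \<in> M" by (intro M_mult) auto
  also have "t j * t j = t (2 * j) + 2" using t_mult[of j 0] by (simp add: t_0)
  finally show False using t_plus_2_notin_M by blast
qed

lemma t_values:
  "t 2 = (t 1)\<^sup>2 - 2" "t 3 = t 1 ^ 3 - 3 * t 1" "t 4 = t 1 ^ 4 - 4 * (t 1)\<^sup>2 + 2"
  "t 6 = (t 3)\<^sup>2 - 2" "t 7 = t 3 * t 4 - t 1" "t 13 = t 6 * t 7 - t 1"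
proof -
  show t2: "t 2 = (t 1)\<^sup>2 - 2" using t_mult[of 1 0] by (simp add: t_0 power2_eq_square algebra_simps numeral_2_eq_2)
  have "t 3 = t 2 * t 1 - t 1" using t_mult[of 1 1] by (simp add: numeral_2_eq_2 numeral_3_eq_3)
  thus t3: "t 3 = t 1 ^ 3 - 3 * t 1" by (simp add: t2 algebra_simps power2_eq_square power3_eq_cube)
  have "t 4 = t 2 * t 2 - 2" using t_mult[of 2 0] by (simp add: t_0)
  thus "t 4 = t 1 ^ 4 - 4 * (t 1)\<^sup>2 + 2"
    unfolding t2 by (simp add: algebra_simps power2_eq_square power4_eq_xxxx)
  show "t 6 = (t 3)\<^sup>2 - 2" using t_mult[of 3 0] by (simp add: t_0 power2_eq_square)
  show "t 7 = t 3 * t 4 - t 1" using t_mult[of 3 1] by (simp add: mult.commute)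
  show "t 13 = t 6 * t 7 - t 1" using t_mult[of 6 1] by (simp add: mult.commute)
qed

lemma t_7_factor_notin_M: "t 1 ^ 3 + (t 1)\<^sup>2 - 2 * t 1 - 1 \<notin> M"
proof
  let ?f = "t 1 ^ 3 + (t 1)\<^sup>2 - 2 * t 1 - 1"
  assume "?f \<in> M"
  hence "(t 1 - 2) * ?f * ?f \<in> M" by (intro M_mult) auto
  also have "(t 1 - 2) * ?f * ?f = t 7 - 2"
    unfolding t_values(5,3,2) by (simp add: algebra_simps eval_nat_numeral)
  finally show False using t_minus_2_notin_M[of 7] nat_dvd_not_less[of 7 r] r_gt_7 by auto
qed

text \<open>
  Over \<open>\<F>\<^sub>3\<close> this is the minimal polynomial of \<open>\<xi> + \<xi>\<^sup>-\<^sup>1\<close> for some of the primitive 26th roots of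
  unity \<open>\<xi>\<close>, so it divides \<open>z\<^sup>-\<^sup>1\<^sup>3 (z\<^sup>1\<^sup>3 + 1)\<^sup>2 = t\<^sub>1\<^sub>3 + 2\<close>.
\<close>
lemma t_13_factor_notin_M: "t 1 ^ 3 - (t 1)\<^sup>2 - t 1 - 1 \<notin> M"
proof
  define x where "x = t 1"
  have x: "x \<in> V" by (simp add: x_def)
  let ?f = "x ^ 3 - x\<^sup>2 - x - 1"
  let ?R = "4 * x - 29 * x ^ 3 - 2 * x ^ 4 + 58 * x ^ 5 - 49 * x ^ 7 + 17 * x ^ 9 - 2 * x ^ 11"
  assume "t 1 ^ 3 - (t 1)\<^sup>2 - t 1 - 1 \<in> M"
  hence "(x + 2) * (x ^ 3 - x + 1)\<^sup>2 * ?f * ?f \<in> M"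
    unfolding x_def[symmetric] using x by (intro M_mult) auto
  moreover have "3 * ?R \<in> M" using x by (intro M_three_mult) auto
  ultimately have "(x + 2) * (x ^ 3 - x + 1)\<^sup>2 * ?f * ?f + 3 * ?R \<in> M" by (rule M_add)
  also have "(x + 2) * (x ^ 3 - x + 1)\<^sup>2 * ?f * ?f + 3 * ?R = t 13 + 2"
    unfolding t_values(6,5,4,3,2) x_def[symmetric]
    by (simp add: algebra_simps eval_nat_numeral)
  finally show False using t_plus_2_notin_M by blast
qed

lemma notin_M_multI: "x \<in> V \<Longrightarrow> y \<in> V \<Longrightarrow> x \<notin> M \<Longrightarrow> y \<notin> M \<Longrightarrow> x * y \<notin> M"
  by (simp add: M_mult_iff)

lemma notin_M_cong: "x = y + 3 * w \<Longrightarrow> w \<in> V \<Longrightarrow> y \<notin> M \<Longrightarrow> x \<notin> M"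
  using M_cong[of x y] M_three_mult[of w] by simp

lemma linear_factor_notin_M: "t 1 - 2 \<notin> M" "t 1 + 2 \<notin> M"
  using t_minus_2_notin_M[of 1] t_plus_2_notin_M[of 1] nat_dvd_not_less[of 1 r] r_gt_7 by auto

text \<open>
  Modulo 3 the expressions \<open>s\<^sub>1\<close>, \<open>s\<^sub>1 + s\<^sub>2\<close> and \<open>s\<^sub>1 - s\<^sub>2\<close> factor, as polynomials in
  \<open>x = t\<^sub>1 = z + 1 / z\<close>, into polynomials whose roots are \<open>\<xi> + \<xi>\<^sup>-\<^sup>1\<close> for roots of unity \<open>\<xi>\<close> of orders
  1, 2, 4, 7, 8 and 26. None of these orders is a prime greater than 7, so all of the factors are
  units. The witnesses \<open>w\<close> are one third of the difference between an expression and its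
  factorization.
\<close>
lemma hasse_123:
  assumes "s1 = t 1 + t 2 + t 3" "s2 = t 1 * t 2 + t 2 * t 3 + t 1 * t 3"
  shows "s1 \<notin> M" "s1 + s2 \<notin> M" "s1 - s2 \<notin> M"
proof -
  define x where "x = t 1"
  have x: "x \<in> V" by (simp add: x_def)
  note factors = linear_factor_notin_M[folded x_def] t_7_factor_notin_M[folded x_def]
    t_13_factor_notin_M[folded x_def] t_notin_M[of 2, unfolded t_values, folded x_def]
  have eqs: "s1 = x + (x\<^sup>2 - 2) + (x ^ 3 - 3 * x)"
    "s2 = x * (x\<^sup>2 - 2) + (x\<^sup>2 - 2) * (x ^ 3 - 3 * x) + x * (x ^ 3 - 3 * x)"
    by (simp_all only: assms t_values(1,2) x_def)
  have "(x - 2) * (x\<^sup>2 - 2) \<notin> M" using x factors by (intro notin_M_multI) auto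
  thus "s1 \<notin> M"
    by (rule notin_M_cong[rotated 2, where w = "-2 + x\<^sup>2"])
       (use x in \<open>auto simp: eqs algebra_simps eval_nat_numeral\<close>)
  have "(x - 2) * (x + 2) * (x ^ 3 + x\<^sup>2 - 2 * x - 1) \<notin> M" using x factors by (intro notin_M_multI) auto
  thus "s1 + s2 \<notin> M"
    by (rule notin_M_cong[rotated 2, where w = "-2 - 2 * x + x\<^sup>2 + x ^ 3"])
       (use x in \<open>auto simp: eqs algebra_simps eval_nat_numeral\<close>)
  have "- ((x - 2) * (x - 2) * (x ^ 3 - x\<^sup>2 - x - 1)) \<notin> M"
    unfolding M_uminus_iff using x factors by (intro notin_M_multI) auto
  thus "s1 - s2 \<notin> M"
    by (rule notin_M_cong[rotated 2, where w = "-2 - 2 * x + x\<^sup>2 + 4 * x ^ 3 - 2 * x ^ 4"])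
       (use x in \<open>auto simp: eqs algebra_simps eval_nat_numeral\<close>)
qed

lemma hasse_124:
  assumes "s1 = t 1 + t 2 + t 4" "s2 = t 1 * t 2 + t 2 * t 4 + t 1 * t 4"
  shows "s1 \<notin> M" "s1 + s2 \<notin> M" "s1 - s2 \<notin> M"
proof -
  define x where "x = t 1"
  have x: "x \<in> V" by (simp add: x_def)
  note factors = linear_factor_notin_M[folded x_def] t_7_factor_notin_M[folded x_def]
    t_notin_M[of 1, folded x_def]
  have eqs: "s1 = x + (x\<^sup>2 - 2) + (x ^ 4 - 4 * x\<^sup>2 + 2)"
    "s2 = x * (x\<^sup>2 - 2) + (x\<^sup>2 - 2) * (x ^ 4 - 4 * x\<^sup>2 + 2) + x * (x ^ 4 - 4 * x\<^sup>2 + 2)"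
    by (simp_all only: assms t_values(1,3) x_def)
  have "x * (x - 2) * (x - 2) * (x - 2) \<notin> M" using x factors by (intro notin_M_multI) auto
  thus "s1 \<notin> M"
    by (rule notin_M_cong[rotated 2, where w = "3 * x - 5 * x\<^sup>2 + 2 * x ^ 3"])
       (use x in \<open>auto simp: eqs algebra_simps eval_nat_numeral\<close>)
  have "(x - 2) * (x - 2) * (x - 2) * (x ^ 3 + x\<^sup>2 - 2 * x - 1) \<notin> M"
    using x factors by (intro notin_M_multI) auto
  thus "s1 + s2 \<notin> M"
    by (rule notin_M_cong[rotated 2, where w = "-4 - x + 11 * x\<^sup>2 - 6 * x ^ 3 - 3 * x ^ 4 + 2 * x ^ 5"])
       (use x in \<open>auto simp: eqs algebra_simps eval_nat_numeral\<close>)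
  have "- ((x - 2) * (x - 2) * (x - 2) * (x - 2) * (x - 2) * (x + 2)) \<notin> M"
    unfolding M_uminus_iff using x factors by (intro notin_M_multI) auto
  thus "s1 - s2 \<notin> M"
    by (rule notin_M_cong[rotated 2, where w = "-20 + 43 * x - 31 * x\<^sup>2 + x ^ 3 + 9 * x ^ 4 - 3 * x ^ 5"])
       (use x in \<open>auto simp: eqs algebra_simps eval_nat_numeral\<close>)
qed

end

section \<open>The Frey curves\<close>

context cyclotomic_prime_above_3
begin

text \<open>
  If \<open>a + z\<^sup>j b \<equiv> 0\<close> with integers \<open>a\<close> and \<open>b\<close> that are not both 0 modulo 3, then \<open>z\<^sup>j\<close> is
  congruent to an element of \<open>\<F>\<^sub>3\<close>, that is, to \<open>1\<close> or \<open>- 1\<close>.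
\<close>
lemma linear_form_notin_M:
  assumes "\<not> r dvd j" "\<not> (3 dvd a \<and> 3 dvd b)"
  shows "of_int a + z ^ j * of_int b \<notin> M"
proof
  assume M: "of_int a + z ^ j * of_int b \<in> M"
  have b: "\<not> 3 dvd b"
  proof
    assume b: "3 dvd b"
    have "(of_int a + z ^ j * of_int b) - z ^ j * of_int b \<in> M"
      using b by (intro M_diff[OF M M_mult]) (auto simp: of_int_mem_M_iff)
    hence "3 dvd a" by (simp add: of_int_mem_M_iff)
    thus False using assms b by simp
  qed
  have "3 dvd a \<or> 3 dvd a - b \<or> 3 dvd a + b" using b by presburger
  then consider "3 dvd a" | "3 dvd a - b" | "3 dvd a + b" by blast
  thus False
  proof cases
    case 1
    have "(of_int a + z ^ j * of_int b) - of_int a \<in> M"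
      using 1 by (intro M_diff[OF M]) (auto simp: of_int_mem_M_iff)
    hence "z ^ j * of_int b \<in> M" by simp
    thus False using b z_power_notin_M[of j] M_mult_iff[of "z ^ j" "of_int b"] by (auto simp: of_int_mem_M_iff)
  next
    case 2
    have "(of_int a + z ^ j * of_int b) - of_int (a - b) \<in> M"
      using 2 by (intro M_diff[OF M]) (simp add: of_int_mem_M_iff del: of_int_diff)
    also have "(of_int a + z ^ j * of_int b) - of_int (a - b) = (z ^ j + 1) * of_int b"
      by (simp add: algebra_simps)
    finally show False
      using b z_power_plus_1_notin_M[of j] M_mult_iff[of "z ^ j + 1" "of_int b"] by (auto simp: of_int_mem_M_iff)
  next
    case 3
    have "(of_int a + z ^ j * of_int b) - of_int (a + b) \<in> M"
      using 3 by (intro M_diff[OF M]) (simp add: of_int_mem_M_iff del: of_int_add)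
    also have "(of_int a + z ^ j * of_int b) - of_int (a + b) = (z ^ j - 1) * of_int b"
      by (simp add: algebra_simps)
    finally show False
      using b z_power_minus_1_notin_M[OF assms(1)] M_mult_iff[of "z ^ j - 1" "of_int b"] by (auto simp: of_int_mem_M_iff)
  qed
qed

text \<open>
  The form is \<open>(a + z\<^sup>j b) (a + z\<^sup>-\<^sup>j b)\<close>, and multiplication by \<open>z\<^sup>j\<close> clears the negative exponent.
\<close>
lemma quadratic_form_notin_M:
  assumes j: "\<not> r dvd j" and ab: "\<not> (3 dvd a \<and> 3 dvd b)"
  shows "of_int a ^ 2 + t j * of_int a * of_int b + of_int b ^ 2 \<notin> M"
proof
  let ?f = "of_int a ^ 2 + t j * of_int a * of_int b + of_int b ^ 2"
  assume "?f \<in> M"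
  hence "z ^ j * ?f \<in> M" by (intro M_mult) auto
  also have "z ^ j * ?f = z ^ j * of_int a ^ 2 + (z ^ j * t j) * of_int a * of_int b + z ^ j * of_int b ^ 2"
    by (simp add: algebra_simps)
  also have "\<dots> = (of_int a + z ^ j * of_int b) * (of_int b + z ^ j * of_int a)"
    unfolding z_power_t power_even_eq by (simp add: algebra_simps power2_eq_square)
  finally show False
    using linear_form_notin_M[OF j ab] linear_form_notin_M[OF j, of b a] ab by (auto simp: M_mult_iff)
qed

text \<open>
  Modulo 3, \<open>B - A \<equiv> s\<^sub>1 (a\<^sup>2 + b\<^sup>2) - s\<^sub>2 a b\<close>, and on the four points \<open>(a : b)\<close> of the
  projective line over \<open>\<F>\<^sub>3\<close> this is \<open>s\<^sub>1\<close> (twice) and, up to sign, \<open>s\<^sub>1 + s\<^sub>2\<close> and \<open>s\<^sub>1 - s\<^sub>2\<close>.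
\<close>
lemma hasse_notin_M:
  fixes \<alpha> \<beta> :: complex and a b :: int
  defines "\<alpha> \<equiv> of_int a" and "\<beta> \<equiv> of_int b"
  assumes x: "x1 \<in> V" "x2 \<in> V" "x3 \<in> V"
    and s: "s1 = x1 + x2 + x3" "s2 = x1 * x2 + x2 * x3 + x1 * x3"
    and units: "s1 \<notin> M" "s1 + s2 \<notin> M" "s1 - s2 \<notin> M"
    and ab: "\<not> (3 dvd a \<and> 3 dvd b)"
  shows "(x1 - x3) * (\<alpha>\<^sup>2 + x2 * \<alpha> * \<beta> + \<beta>\<^sup>2) - (x3 - x2) * (\<alpha>\<^sup>2 + x1 * \<alpha> * \<beta> + \<beta>\<^sup>2) \<notin> M" (is "?D \<notin> M")
proof
  assume D: "?D \<in> M"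
  have V: "\<alpha> \<in> V" "\<beta> \<in> V" "s1 \<in> V" "s2 \<in> V" using x by (auto simp: \<alpha>_def \<beta>_def s)
  define G where "G = s1 * (\<alpha>\<^sup>2 + \<beta>\<^sup>2) - s2 * (\<alpha> * \<beta>)"
  have "G = ?D - 3 * (x1 * x2 * \<alpha> * \<beta> - x3 * (\<alpha>\<^sup>2 + \<beta>\<^sup>2))"
    by (simp add: G_def s algebra_simps power2_eq_square)
  also have "\<dots> \<in> M" using x V by (intro M_diff[OF D M_three_mult]) auto
  finally have G: "G \<in> M" .
  have mem: "of_int n \<in> M" if "3 dvd n" for n using that by (simp add: of_int_mem_M_iff)
  have unit: "\<And>n. of_int n ^ 2 \<in> M \<Longrightarrow> 3 dvd n" by (simp add: M_power_iff of_int_mem_M_iff)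
  have "3 dvd a \<or> 3 dvd b \<or> 3 dvd a - b \<or> 3 dvd a + b" by presburger
  then consider "3 dvd a" | "3 dvd b" | "\<not> 3 dvd b" "3 dvd a - b" | "\<not> 3 dvd b" "3 dvd a + b" by blast
  thus False
  proof cases
    case 1
    have "s1 * \<beta>\<^sup>2 = G - (s1 * \<alpha> - s2 * \<beta>) * \<alpha>" by (simp add: G_def algebra_simps power2_eq_square)
    also have "\<dots> \<in> M" using V mem[OF 1] by (intro M_diff[OF G M_mult]) (auto simp: \<alpha>_def)
    finally have "\<beta>\<^sup>2 \<in> M" using M_prime[of s1 "\<beta>\<^sup>2"] V units by auto
    thus False using unit[of b] ab 1 by (simp add: \<beta>_def)
  next
    case 2
    have "s1 * \<alpha>\<^sup>2 = G - (s1 * \<beta> - s2 * \<alpha>) * \<beta>" by (simp add: G_def algebra_simps power2_eq_square)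
    also have "\<dots> \<in> M" using V mem[OF 2] by (intro M_diff[OF G M_mult]) (auto simp: \<beta>_def)
    finally have "\<alpha>\<^sup>2 \<in> M" using M_prime[of s1 "\<alpha>\<^sup>2"] V units by auto
    thus False using unit[of a] ab 2 by (simp add: \<alpha>_def)
  next
    case 3
    have d: "\<alpha> - \<beta> \<in> M" using mem[OF 3(2)] by (simp add: \<alpha>_def \<beta>_def)
    have "(s1 + s2) * \<beta>\<^sup>2 = 3 * (s1 * \<beta>\<^sup>2) + (s1 * (\<alpha> + \<beta>) - s2 * \<beta>) * (\<alpha> - \<beta>) - G"
      by (simp add: G_def algebra_simps power2_eq_square)
    also have "\<dots> \<in> M" using V by (intro M_diff[OF M_add[OF M_three_mult M_mult[OF _ d]] G]) auto
    finally have "\<beta>\<^sup>2 \<in> M" using M_prime[of "s1 + s2" "\<beta>\<^sup>2"] V units by auto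
    thus False using unit[of b] 3 by (simp add: \<beta>_def)
  next
    case 4
    have d: "\<alpha> + \<beta> \<in> M" using mem[OF 4(2)] by (simp add: \<alpha>_def \<beta>_def)
    have "(s1 - s2) * \<beta>\<^sup>2 = 3 * (s1 * \<beta>\<^sup>2) + (s1 * (\<alpha> - \<beta>) - s2 * \<beta>) * (\<alpha> + \<beta>) - G"
      by (simp add: G_def algebra_simps power2_eq_square)
    also have "\<dots> \<in> M" using V by (intro M_diff[OF M_add[OF M_three_mult M_mult[OF _ d]] G]) auto
    finally have "\<beta>\<^sup>2 \<in> M" using M_prime[of "s1 - s2" "\<beta>\<^sup>2"] V units by auto
    thus False using unit[of b] 4 by (simp add: \<beta>_def)
  qed
qed

text \<open>The identity \<open>A + B = (t\<^sub>1 - t\<^sub>2) (a\<^sup>2 + t\<^sub>k a b + b\<^sup>2)\<close>, where \<open>k\<close> is the third index, gives all three differences of the roots the same form.\<close>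
lemma frey_good_ordinary:
  assumes k: "k3 = 3 \<or> k3 = (4 :: nat)" and ab: "\<not> (3 dvd a \<and> 3 dvd b)"
    and A: "A = (t k3 - t 2) * (of_int a ^ 2 + t 1 * of_int a * of_int b + of_int b ^ 2)"
    and B: "B = (t 1 - t k3) * (of_int a ^ 2 + t 2 * of_int a * of_int b + of_int b ^ 2)"
  shows "good_ordinary_reduction 3 K P (Weierstrass 0 (9 ^ n * (B - A)) 0 (- (9 ^ n * A * (9 ^ n * B))) 0)"
proof (rule good_ordinary_reductionI)
  have nd: "\<not> r dvd j" if "0 < j" "j \<le> 7" for j
    using that nat_dvd_not_less[of j r] r_gt_7 by simp
  show "A \<in> V" "B \<in> V" unfolding A B by auto
  have "t k3 - t 2 \<notin> M"
    using k t_diff_notin_M[of 1 2, OF nd nd] t_diff_notin_M[of 2 2, OF nd nd] by auto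
  thus "A \<notin> M"
    unfolding A using quadratic_form_notin_M[OF nd[of 1] ab] by (intro notin_M_multI) auto
  have "t k3 - t 1 \<notin> M"
    using k t_diff_notin_M[of 2 1, OF nd nd] t_diff_notin_M[of 3 1, OF nd nd] by (auto simp: eval_nat_numeral)
  hence "t 1 - t k3 \<notin> M" using M_diff_commute by blast
  thus "B \<notin> M"
    unfolding B using quadratic_form_notin_M[OF nd[of 2] ab] by (intro notin_M_multI) auto
  have AB: "A + B = (t 1 - t 2) * (of_int a ^ 2 + t k3 * of_int a * of_int b + of_int b ^ 2)"
    unfolding A B by (simp add: algebra_simps power2_eq_square)
  have "t 2 - t 1 \<notin> M" using t_diff_notin_M[of 1 1, OF nd nd] by (simp add: numeral_2_eq_2)
  hence "t 1 - t 2 \<notin> M" using M_diff_commute by blast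
  thus "A + B \<notin> M"
    unfolding AB using quadratic_form_notin_M[OF nd[of k3] ab] k by (intro notin_M_multI) auto
  show "B - A \<notin> M"
    unfolding A B using k hasse_notin_M[OF t_V t_V t_V refl refl hasse_123[OF refl refl] ab]
      hasse_notin_M[OF t_V t_V t_V refl refl hasse_124[OF refl refl] ab] by blast
qed

end

lemma not_both_divisible_by_3:
  fixes a b :: int
  assumes "(a, b) \<noteq> (0, 0)"
  shows "\<exists>n a' b'. a = 3 ^ n * a' \<and> b = 3 ^ n * b' \<and> \<not> (3 dvd a' \<and> 3 dvd b')"
  using assms
proof (induction "nat (\<bar>a\<bar> + \<bar>b\<bar>)" arbitrary: a b rule: less_induct)
  case less
  show ?case
  proof (cases "3 dvd a \<and> 3 dvd b")
    case True
    then obtain c d where cd: "a = 3 * c" "b = 3 * d" by blast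
    have "(c, d) \<noteq> (0, 0)" using less.prems cd by auto
    moreover have "nat (\<bar>c\<bar> + \<bar>d\<bar>) < nat (\<bar>a\<bar> + \<bar>b\<bar>)" using less.prems cd by auto
    ultimately obtain n a' b' where "c = 3 ^ n * a'" "d = 3 ^ n * b'" "\<not> (3 dvd a' \<and> 3 dvd b')"
      using less.hyps by blast
    thus ?thesis using cd by (intro exI[of _ "Suc n"] exI[of _ a'] exI[of _ b']) auto
  next
    case False
    thus ?thesis by (intro exI[of _ 0] exI[of _ a] exI[of _ b]) auto
  qed
qed

text \<open>
  Otherwise \<open>\<bar>a\<bar> = \<bar>b\<bar>\<close> and \<open>z\<^sup>j = - 1\<close>, which is not a root of unity of odd order.
\<close>
lemma linear_form_nonzero:
  fixes z :: complex
  assumes "odd r" "z ^ r = 1" "z ^ j \<noteq> 1" and ab: "(a, b) \<noteq> (0, 0 :: int)"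
  shows "of_int a + z ^ j * of_int b \<noteq> 0"
proof
  assume eq: "of_int a + z ^ j * of_int b = 0"
  have zjr: "(z ^ j) ^ r = 1" by (metis assms(2) mult.commute power_mult power_one)
  have "r > 0" using assms(1) odd_pos by blast
  hence "norm (z ^ j) = 1" using power_eq_1_iff[OF zjr] by simp
  moreover have "of_int a = - (z ^ j * of_int b)" using eq by (simp add: eq_neg_iff_add_eq_0)
  ultimately have "norm (of_int a :: complex) = norm (of_int b :: complex)"
    by (simp add: norm_mult)
  hence "\<bar>a\<bar> = \<bar>b\<bar>" by (simp flip: of_int_abs)
  hence "a = b \<or> a = - b" by linarith
  moreover from this have "of_int b \<noteq> (0 :: complex)" using ab by auto
  moreover have "of_int b * (z ^ j + 1) = 0" if "a = b"
    using eq that by (simp add: algebra_simps)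
  moreover have "of_int b * (z ^ j - 1) = 0" if "a = - b"
    using eq that by (simp add: algebra_simps)
  ultimately have "z ^ j = - 1" using assms(3) by (auto simp: eq_neg_iff_add_eq_0)
  thus False using zjr assms(1) by simp
qed

lemma quadratic_form_nonzero:
  assumes z: "odd r" "z ^ r = 1" "z ^ j \<noteq> 1" and ab: "(a, b) \<noteq> (0, 0 :: int)"
  shows "of_int a ^ 2 + root_sum z j * of_int a * of_int b + of_int b ^ 2 \<noteq> 0"
proof
  let ?f = "of_int a ^ 2 + root_sum z j * of_int a * of_int b + of_int b ^ 2"
  assume f: "?f = 0"
  have z0: "z \<noteq> 0" using z(1,2) odd_pos[of r] by (auto simp: power_0_left)
  have "z ^ j * ?f = z ^ j * of_int a ^ 2 + (z ^ j * root_sum z j) * of_int a * of_int b + z ^ j * of_int b ^ 2"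
    by (simp add: algebra_simps)
  also have "\<dots> = (of_int a + z ^ j * of_int b) * (of_int b + z ^ j * of_int a)"
    unfolding power_mult_root_sum[OF z0] power_even_eq by (simp add: algebra_simps power2_eq_square)
  finally show False
    using f linear_form_nonzero[OF z, of a b] linear_form_nonzero[OF z, of b a] ab by auto
qed

lemma root_sum_diff_nonzero:
  assumes "z \<noteq> 0" "z ^ n \<noteq> 1" "z ^ (2 * j + n) \<noteq> 1"
  shows "root_sum z (j + n) - root_sum z j \<noteq> 0"
  using root_sum_diff[OF assms(1), of j n] assms by auto

lemma root_sum_mem_adjoin_rat: "root_sum z j \<in> adjoin_rat z"
  using field_subring.add_mem[OF field_subring_adjoin_rat]
    field_subring.power_mem[OF field_subring_adjoin_rat adjoin_rat_self] adjoin_rat_inverse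
  unfolding root_sum_def by blast

lemma frey_A_root_sum:
  "frey_A z (1, 2, int k3) a b =
     (root_sum z k3 - root_sum z 2) * (of_int a ^ 2 + root_sum z 1 * of_int a * of_int b + of_int b ^ 2)"
  using zeta_sum_eq_root_sum[of z 1] zeta_sum_eq_root_sum[of z 2]
  by (simp add: frey_A_def zeta_sum_eq_root_sum)

lemma frey_B_root_sum:
  "frey_B z (1, 2, int k3) a b =
     (root_sum z 1 - root_sum z k3) * (of_int a ^ 2 + root_sum z 2 * of_int a * of_int b + of_int b ^ 2)"
  using zeta_sum_eq_root_sum[of z 1] zeta_sum_eq_root_sum[of z 2]
  by (simp add: frey_B_def zeta_sum_eq_root_sum)

lemma frey_curve_eq:
  "frey_curve z k a b = Weierstrass 0 (frey_B z k a b - frey_A z k a b) 0 (- (frey_A z k a b * frey_B z k a b)) 0"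
  by (simp add: frey_curve_def Let_def)

lemma frey_elliptic:
  assumes r: "prime r" "r > 7" and z: "primitive_root_of_unity r z"
    and k: "k3 = 3 \<or> k3 = (4 :: nat)" and ab: "(a, b) \<noteq> (0, 0)"
  shows "elliptic_curve_over (adjoin_rat z) (frey_curve z (1, 2, int k3) a b)"
proof -
  interpret K: field_subring "adjoin_rat z" by (rule field_subring_adjoin_rat)
  let ?A = "frey_A z (1, 2, int k3) a b" and ?B = "frey_B z (1, 2, int k3) a b"
  have odd: "odd r" using prime_odd_nat[OF r(1)] r(2) by simp
  have zr: "z ^ r = 1" and neq: "\<And>m. 0 < m \<Longrightarrow> m \<le> 7 \<Longrightarrow> z ^ m \<noteq> 1"
    using z r by (auto simp: primitive_root_of_unity_def)
  have z0: "z \<noteq> 0" using zr r by (auto simp: power_0_left)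
  note quad = quadratic_form_nonzero[OF odd zr neq ab]
  note diff = root_sum_diff_nonzero[OF z0 neq neq]
  have "root_sum z k3 - root_sum z 2 \<noteq> 0" using k diff[of 1 2] diff[of 2 2] by auto
  hence A: "?A \<noteq> 0" unfolding frey_A_root_sum using quad[of 1] by simp
  have "root_sum z k3 - root_sum z 1 \<noteq> 0" using k diff[of 2 1] diff[of 3 1] by (auto simp: eval_nat_numeral)
  hence B: "?B \<noteq> 0" unfolding frey_B_root_sum using quad[of 2] by simp
  have AB: "?A + ?B = (root_sum z 1 - root_sum z 2) * (of_int a ^ 2 + root_sum z k3 * of_int a * of_int b + of_int b ^ 2)"
    unfolding frey_A_root_sum frey_B_root_sum by (simp add: algebra_simps power2_eq_square)
  have "root_sum z 2 - root_sum z 1 \<noteq> 0" using diff[of 1 1] by (simp add: numeral_2_eq_2)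
  hence "?A + ?B \<noteq> 0" unfolding AB using quad[of k3] k by auto
  hence "discriminant (frey_curve z (1, 2, int k3) a b) \<noteq> 0"
    unfolding frey_curve_eq discriminant_two_torsion using A B by simp
  moreover have "?A \<in> adjoin_rat z" "?B \<in> adjoin_rat z"
    unfolding frey_A_root_sum frey_B_root_sum
    using root_sum_mem_adjoin_rat[of z] by auto
  hence "set_weierstrass (frey_curve z (1, 2, int k3) a b) \<subseteq> adjoin_rat z"
    unfolding frey_curve_eq by auto
  ultimately show ?thesis by (simp add: elliptic_curve_over_def)
qed

lemma frey_ordinary_at_3:
  assumes r: "prime r" "r > 7" and z: "primitive_root_of_unity r z"
    and k: "k3 = 3 \<or> k3 = (4 :: nat)" and ab: "(a, b) \<noteq> (0, 0)"
  shows "ordinary_at 3 (adjoin_rat z) (frey_curve z (1, 2, int k3) a b)"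
  unfolding ordinary_at_def
proof
  fix P assume P: "P \<in> primes_above 3 (adjoin_rat z)"
  interpret cyclotomic_prime_above_3 r z P
  proof
    have "\<not> r dvd 3" using r(2) nat_dvd_not_less[of 3 r] by simp
    thus "coprime 3 r" using prime_imp_coprime[OF r(1)] coprime_commute by blast
  qed (use r z P in \<open>auto simp: primitive_root_of_unity_def\<close>)
  obtain n c d where n: "a = 3 ^ n * c" "b = 3 ^ n * d" and cd: "\<not> (3 dvd c \<and> 3 dvd d)"
    using not_both_divisible_by_3[OF ab] by blast
  let ?A = "frey_A z (1, 2, int k3) c d" and ?B = "frey_B z (1, 2, int k3) c d"
  have "(9 :: complex) ^ n = (3 * 3) ^ n" by simp
  hence nine: "(9 :: complex) ^ n = 3 ^ n * 3 ^ n" by (simp only: power_mult_distrib)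
  have "frey_A z (1, 2, int k3) a b = 9 ^ n * ?A" "frey_B z (1, 2, int k3) a b = 9 ^ n * ?B"
    unfolding frey_A_root_sum frey_B_root_sum n nine by (simp_all add: algebra_simps power2_eq_square)
  hence "frey_curve z (1, 2, int k3) a b = Weierstrass 0 (9 ^ n * (?B - ?A)) 0 (- (9 ^ n * ?A * (9 ^ n * ?B))) 0"
    by (simp add: frey_curve_eq right_diff_distrib)
  thus "good_ordinary_reduction 3 (adjoin_rat z) P (frey_curve z (1, 2, int k3) a b)"
    using frey_good_ordinary[OF k cd frey_A_root_sum frey_B_root_sum] by simp
qed

theorem theorem3:
  fixes k :: "int \<times> int \<times> int" and r :: nat and \<zeta> :: complex and a b :: int
  assumes "k = (1, 2, 3) \<or> k = (1, 2, 4)"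
    and "prime r" and "r > 7"
    and "primitive_root_of_unity r \<zeta>"
    and "(a, b) \<noteq> (0, 0)"
  shows "elliptic_curve_over (adjoin_rat \<zeta>) (frey_curve \<zeta> k a b) \<and>
    ordinary_at 3 (adjoin_rat \<zeta>) (frey_curve \<zeta> k a b)"
proof -
  obtain k3 :: nat where "k3 = 3 \<or> k3 = 4" "k = (1, 2, int k3)"
    using assms(1) by (metis of_nat_numeral)
  thus ?thesis
    using frey_elliptic[OF assms(2-4) _ assms(5)] frey_ordinary_at_3[OF assms(2-4) _ assms(5)] by blast
qed

end
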